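(* Let $\Gamma$ be an abelian group of order $m$ and let $G\in(\mathbb{C}^{\Gamma\times\Gamma})^{t\times t}$, with blocks $G_{i,j}\in\mathbb{C}^{\Gamma\times\Gamma}$ for $i,j\in[t]$. The following are equivalent: (a) $G$ is the Gram matrix of a $t$-generator $\Gamma$-harmonic collection of vectors. (b) $G$ is positive semidefinite and each block $G_{i,j}$ is $\Gamma$-stable, that is, $(G_{i,j})_{k+g,k+h}=(G_{i,j})_{g,h}$ for every $g,h,k\in\Gamma$. (c) Each block $G_{i,j}$ is diagonalized by the Fourier transform matrix $F\in\mathbb{C}^{\hat\Gamma\times\Gamma}$ defined by $F_{\alpha,g}=\frac{1}{\sqrt m}\overline{\alpha(g)}$ for $\alpha\in\hat\Gamma$, $g\in\Gamma$ (that is, $FG_{i,j}F^{-1}$ is diagonal), and each matrix $H_\alpha\in\mathbb{C}^{t\times t}$ ($\alpha\in\hat\Gamma$) defined by $(H_\alpha)_{i,j}=(FG_{i,j}F^{-1})_{\alpha,\alpha}$ for $i,j\in[t]$ is positive semidefinite. If in addition to the equivalent conditions (a), (b), (c), $G$ satisfies both \[ G^2=tG\qquad\text{and}\qquad \sum_{i\in[t]}G_{i,i}=tI, \] then $G$ is the Gram matrix of a $t$-generator $\Gamma$-harmonic collection of vectors in $\mathbb{C}^m$, where the underlying representation is the regular representation of $\Gamma$. In particular, if this holds and $\Gamma=C_m$, then $G$ is the Gram matrix of a $t$-circulant equiangular tight frame.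
   Context: $[t]=\{1,\ldots,t\}$. $C_m$ denotes the cyclic group of order $m$. $I$ denotes the identity matrix. $(\mathbb{C}^{\Gamma\times\Gamma})^{t\times t}$ denotes complex $t\times t$ block matrices whose blocks have rows and columns indexed by $\Gamma$. $\hat\Gamma$ is the Pontryagin dual of $\Gamma$ (the group of homomorphisms from $\Gamma$ to the unit circle under pointwise multiplication). Inner products are conjugate-linear in the left entry. Given a finite abelian group $\Gamma$, a unitary representation $\rho\colon\Gamma\to U(d)$ (for some $d$), and vectors $\psi_1,\ldots,\psi_t\in\mathbb{C}^d$, the collection $\{\rho(g)\psi_i\}_{g\in\Gamma,i\in[t]}$ is called $t$-generator $\Gamma$-harmonic with underlying representation $\rho$. Its Gram matrix is the matrix in $(\mathbb{C}^{\Gamma\times\Gamma})^{t\times t}$ with $(G_{i,j})_{g,h}=\langle\rho(g)\psi_i,\rho(h)\psi_j\rangle$. The regular representation of $\Gamma$ is $\rho\colon\Gamma\to U(\mathbb{C}^\Gamma)$ given by $(\rho(g)\varphi)_h=\varphi_{h-g}$ for $\varphi\in\mathbb{C}^\Gamma$, $g,h\in\Gamma$; here $\mathbb{C}^\Gamma$ is identified with $\mathbb{C}^m$. A $d\times n$ equiangular tight frame (ETF) is a matrix $\Phi\in\mathbb{C}^{d\times n}$ with unit-norm columns such that all off-diagonal entries of $\Phi^*\Phi$ have the same modulus and $\Phi\Phi^*$ is a multiple of the identity. A $d\times td$ matrix consisting of $t$ side-by-side $d\times d$ blocks is $t$-circulant if each block is a circulant matrix.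
   Formalization: The last claim is false as written (m = t = 2, all blocks I): the formal statement gives a t-circulant tight frame with Gram matrix G, and an equiangular tight frame when G also has unit diagonal and off-diagonal entries of equal modulus. *)

theory Defs
  imports
    "HOL-Analysis.Analysis"
    "Jordan_Normal_Form.Schur_Decomposition"
begin

text \<open>
  Matrices whose rows and columns are indexed by the group, by its dual or by the set of generators
  are matrices over finite types, as in \<^theory>\<open>HOL-Analysis.Finite_Cartesian_Product\<close>.
  Where the dimension is a number that is quantified inside a formula (the dimension of a
  representation space) or where the order of the rows and columns matters (circulant matrices), the
  carrier-based matrices of \<^theory>\<open>Jordan_Normal_Form.Matrix\<close> are used instead.
  Both theories write \<open>$\<close> and \<open>mat\<close>; below, these are the ones for finite types.
\<close>

no_notation Matrix.vec_index (infixl \<open>$\<close> 100)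
hide_const (open) Matrix.mat Matrix.vec
hide_type (open) Matrix.vec

type_synonym 'n square = "complex ^ 'n ^ 'n"

section \<open>The Pontryagin dual and the Fourier matrix\<close>

typedef (overloaded) ('g :: ab_group_add) pontryagin_dual =
  "{\<alpha> :: 'g \<Rightarrow> complex. (\<forall>g. cmod (\<alpha> g) = 1) \<and> (\<forall>g h. \<alpha> (g + h) = \<alpha> g * \<alpha> h)}"
  morphisms character Abs_pontryagin_dual
  by (rule exI[of _ "\<lambda>_. 1"]) simp

lemma character_power_card:
  fixes \<alpha> :: "'g :: {ab_group_add, finite} pontryagin_dual"
  shows "character \<alpha> g ^ CARD('g) = 1"
proof -
  have norm: "cmod (character \<alpha> h) = 1"
    and add: "character \<alpha> (h + k) = character \<alpha> h * character \<alpha> k" for h k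
    using character[of \<alpha>] by auto
  let ?P = "\<Prod>h\<in>UNIV. character \<alpha> h"
  have "?P = (\<Prod>h\<in>UNIV. character \<alpha> (g + h))"
    by (rule prod.reindex_bij_witness[of _ "\<lambda>h. g + h" "\<lambda>h. h - g"]) auto
  also have "\<dots> = character \<alpha> g ^ CARD('g) * ?P"
    by (simp add: add prod.distrib)
  finally have "?P = character \<alpha> g ^ CARD('g) * ?P" .
  moreover have "character \<alpha> h \<noteq> 0" for h
    using norm[of h] by auto
  then have "?P \<noteq> 0"
    by simp
  ultimately show ?thesis
    by simp
qed

instance pontryagin_dual :: ("{ab_group_add, finite}") finite
proof
  have "finite {z :: complex. z ^ CARD('a) = 1}"
    by (rule finite_roots_unity) (simp add: Suc_leI)
  then have "finite (Pi\<^sub>E (UNIV :: 'a set) (\<lambda>_. {z :: complex. z ^ CARD('a) = 1}))"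
    by (intro finite_PiE) auto
  moreover have "range character \<subseteq> Pi\<^sub>E (UNIV :: 'a set) (\<lambda>_. {z :: complex. z ^ CARD('a) = 1})"
    by (auto simp: character_power_card)
  ultimately have "finite (range (character :: 'a pontryagin_dual \<Rightarrow> _))"
    by (rule finite_subset[rotated])
  then show "finite (UNIV :: 'a pontryagin_dual set)"
    by (rule finite_imageD) (simp add: inj_on_def character_inject)
qed

definition fourier_matrix :: "complex ^ ('g :: {ab_group_add, finite}) ^ ('g pontryagin_dual)" where
  "fourier_matrix = (\<chi> \<alpha> g. cnj (character \<alpha> g) / complex_of_real (sqrt (real CARD('g))))"

definition fourier_conj ::
  "('g :: {ab_group_add, finite}) square \<Rightarrow> 'g pontryagin_dual square" where
  "fourier_conj A = fourier_matrix ** A ** matrix_inv fourier_matrix"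

section \<open>Block matrices\<close>

text \<open>
  A \<open>t \<times> t\<close> matrix of blocks indexed by the group is a matrix indexed by pairs of a generator index
  and a group element.
\<close>

definition block :: "('t :: finite \<times> 'g :: finite) square \<Rightarrow> 't \<Rightarrow> 't \<Rightarrow> 'g square" where
  "block G i j = (\<chi> g h. G $ (i, g) $ (j, h))"

definition psd :: "('n :: finite) square \<Rightarrow> bool" where
  "psd A \<longleftrightarrow> (\<forall>i j. A $ i $ j = cnj (A $ j $ i)) \<and>
     (\<forall>x :: complex ^ 'n. 0 \<le> Re (\<Sum>i\<in>UNIV. cnj (x $ i) * (A *v x) $ i))"

definition diagonal :: "('n :: finite) square \<Rightarrow> bool" where
  "diagonal A \<longleftrightarrow> (\<forall>i j. i \<noteq> j \<longrightarrow> A $ i $ j = 0)"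

definition group_stable :: "('g :: {ab_group_add, finite}) square \<Rightarrow> bool" where
  "group_stable A \<longleftrightarrow> (\<forall>g h k. A $ (k + g) $ (k + h) = A $ g $ h)"

definition fourier_slice ::
  "('t :: finite \<times> 'g :: {ab_group_add, finite}) square \<Rightarrow> 'g pontryagin_dual \<Rightarrow> 't square" where
  "fourier_slice G \<alpha> = (\<chi> i j. fourier_conj (block G i j) $ \<alpha> $ \<alpha>)"

section \<open>Harmonic collections\<close>

definition unitary_rep :: "nat \<Rightarrow> ('g :: ab_group_add \<Rightarrow> complex mat) \<Rightarrow> bool" where
  "unitary_rep d \<rho> \<longleftrightarrow>
     (\<forall>g. \<rho> g \<in> carrier_mat d d \<and> mat_adjoint (\<rho> g) * \<rho> g = 1\<^sub>m d) \<and>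
     (\<forall>g h. \<rho> (g + h) = \<rho> g * \<rho> h)"

definition harmonic ::
  "nat \<Rightarrow> ('g :: ab_group_add \<Rightarrow> complex mat) \<Rightarrow> ('t \<Rightarrow> complex Matrix.vec) \<Rightarrow> bool" where
  "harmonic d \<rho> \<psi> \<longleftrightarrow> unitary_rep d \<rho> \<and> (\<forall>i. \<psi> i \<in> carrier_vec d)"

text \<open>
  \<open>v \<bullet>c w\<close> conjugates \<open>w\<close>, so the arguments are swapped to obtain the inner product that is
  conjugate-linear on the left.
\<close>

definition harmonic_gram ::
  "('g :: finite \<Rightarrow> complex mat) \<Rightarrow> ('t :: finite \<Rightarrow> complex Matrix.vec) \<Rightarrow> ('t \<times> 'g) square" where
  "harmonic_gram \<rho> \<psi> =
     (\<chi> p q. (\<rho> (snd q) *\<^sub>v \<psi> (fst q)) \<bullet>c (\<rho> (snd p) *\<^sub>v \<psi> (fst p)))"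

definition is_harmonic_gram ::
  "nat \<Rightarrow> ('g :: {ab_group_add, finite} \<Rightarrow> complex mat) \<Rightarrow> ('t :: finite \<times> 'g) square \<Rightarrow> bool" where
  "is_harmonic_gram d \<rho> G \<longleftrightarrow> (\<exists>\<psi>. harmonic d \<rho> \<psi> \<and> G = harmonic_gram \<rho> \<psi>)"

text \<open>
  The functions on the group are identified with vectors of length \<open>CARD('g)\<close> by means of an
  enumeration \<open>e\<close> of the group. Entry \<open>(a, b)\<close> is \<open>1\<close> if \<open>e b = e a - g\<close>, so that \<open>regular_rep e g\<close>
  takes \<open>\<phi>\<close> to \<open>\<lambda>h. \<phi> (h - g)\<close>.
\<close>

definition group_enumeration :: "(nat \<Rightarrow> 'g) \<Rightarrow> bool" where
  "group_enumeration e \<longleftrightarrow> bij_betw e {..<CARD('g)} (UNIV :: 'g set)"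

definition regular_rep :: "(nat \<Rightarrow> 'g :: ab_group_add) \<Rightarrow> 'g \<Rightarrow> complex mat" where
  "regular_rep e g = Matrix.mat CARD('g) CARD('g) (\<lambda>(a, b). if e b = e a - g then 1 else 0)"

section \<open>Circulant equiangular tight frames\<close>

text \<open>An enumeration that is an isomorphism from the integers modulo the order of the group.\<close>

definition cyclic_enumeration :: "(nat \<Rightarrow> 'g :: ab_group_add) \<Rightarrow> bool" where
  "cyclic_enumeration e \<longleftrightarrow> group_enumeration e \<and>
     (\<forall>k<CARD('g). \<forall>l<CARD('g). e ((k + l) mod CARD('g)) = e k + e l)"

definition circulant :: "complex mat \<Rightarrow> bool" where
  "circulant A \<longleftrightarrow> square_mat A \<and>
     (\<forall>i<dim_row A. \<forall>j<dim_row A. A $$ (Suc i mod dim_row A, Suc j mod dim_row A) = A $$ (i, j))"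

definition t_circulant :: "nat \<Rightarrow> complex mat \<Rightarrow> bool" where
  "t_circulant t \<Phi> \<longleftrightarrow> dim_col \<Phi> = t * dim_row \<Phi> \<and>
     (\<forall>b<t. circulant (Matrix.mat (dim_row \<Phi>) (dim_row \<Phi>) (\<lambda>(i, j). \<Phi> $$ (i, b * dim_row \<Phi> + j))))"

definition tight_frame :: "complex mat \<Rightarrow> bool" where
  "tight_frame \<Phi> \<longleftrightarrow> (\<exists>c. \<Phi> * mat_adjoint \<Phi> = c \<cdot>\<^sub>m 1\<^sub>m (dim_row \<Phi>))"

definition equiangular_tight_frame :: "complex mat \<Rightarrow> bool" where
  "equiangular_tight_frame \<Phi> \<longleftrightarrow>
     (\<forall>k<dim_col \<Phi>. col \<Phi> k \<bullet>c col \<Phi> k = 1) \<and>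
     (\<exists>\<mu>. \<forall>k<dim_col \<Phi>. \<forall>l<dim_col \<Phi>. k \<noteq> l \<longrightarrow> cmod ((mat_adjoint \<Phi> * \<Phi>) $$ (k, l)) = \<mu>) \<and>
     tight_frame \<Phi>"

text \<open>
  \<open>G\<close> is the Gram matrix of the columns of \<open>\<Phi>\<close>, where \<open>s\<close> lists the blocks and \<open>e\<close> lists the
  columns inside a block.
\<close>

definition gram_of_columns ::
  "(nat \<Rightarrow> 't :: finite) \<Rightarrow> (nat \<Rightarrow> 'g :: finite) \<Rightarrow> ('t \<times> 'g) square \<Rightarrow> complex mat \<Rightarrow> bool" where
  "gram_of_columns s e G \<Phi> \<longleftrightarrow> dim_col \<Phi> = CARD('t) * CARD('g) \<and>
     (\<forall>a<CARD('t). \<forall>k<CARD('g). \<forall>b<CARD('t). \<forall>l<CARD('g).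
        G $ (s a, e k) $ (s b, e l)
          = (mat_adjoint \<Phi> * \<Phi>) $$ (a * CARD('g) + k, b * CARD('g) + l))"

text \<open>
  That a Gram matrix \<open>G\<close> satisfies \<open>G\<^sup>2 = t G\<close> and that its diagonal blocks add up to \<open>t I\<close> makes the
  frame tight but not equiangular: for \<open>t = 2\<close> and any group of order at least \<open>2\<close>, the matrix all of
  whose blocks are \<open>I\<close> has both properties. Equiangularity is therefore a condition of its own.
\<close>

definition equiangular_gram :: "('n :: finite) square \<Rightarrow> bool" where
  "equiangular_gram G \<longleftrightarrow> (\<forall>p. G $ p $ p = 1) \<and> (\<exists>\<mu>. \<forall>p q. p \<noteq> q \<longrightarrow> cmod (G $ p $ q) = \<mu>)"

end

theory Submission
  imports Defs
begin

text \<open>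
  A block is \<open>\<Gamma>\<close>-stable iff it is diagonal in the basis of characters, so a \<open>\<Gamma>\<close>-stable \<open>G\<close> satisfies
  \<open>G (i, g) (j, h) = 1/m \<Sum>\<^sub>\<alpha> H\<^sub>\<alpha> i j \<alpha>(g) cnj (\<alpha>(h))\<close>. A Cholesky factorisation \<open>H\<^sub>\<alpha> = B\<^sub>\<alpha>\<^sup>* B\<^sub>\<alpha>\<close>
  of each slice exhibits \<open>G\<close> as the Gram matrix of the orbits of \<open>t\<close> vectors under a diagonal
  representation. The two extra conditions on \<open>G\<close> become \<open>H\<^sub>\<alpha>\<^sup>2 = t H\<^sub>\<alpha>\<close> and \<open>tr H\<^sub>\<alpha> = t\<close>, so every slice
  has rank one, \<open>H\<^sub>\<alpha> i j = cnj (b\<^sub>\<alpha> i) b\<^sub>\<alpha> j\<close>; the functions \<open>\<psi>\<^sub>i = 1/m \<Sum>\<^sub>\<alpha> b\<^sub>\<alpha> i \<alpha>\<close> then generate \<open>G\<close> under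
  the regular representation, whose translates are the columns of circulant blocks.
\<close>

section \<open>Characters\<close>

lemma cmod_character [simp]: "cmod (character \<alpha> g) = 1"
  and character_add: "character \<alpha> (g + h) = character \<alpha> g * character \<alpha> h"
  using character[of \<alpha>] by auto

lemma character_0 [simp]: "character \<alpha> 0 = 1"
proof -
  have "character \<alpha> 0 \<noteq> 0"
    by (metis cmod_character norm_zero zero_neq_one)
  then show ?thesis
    using character_add[of \<alpha> 0 0] by simp
qed

lemma character_mult_cnj [simp]:
  "character \<alpha> g * cnj (character \<alpha> g) = 1" "cnj (character \<alpha> g) * character \<alpha> g = 1"
proof -
  show "character \<alpha> g * cnj (character \<alpha> g) = 1"
    using complex_norm_square[of "character \<alpha> g"] by simp
  then show "cnj (character \<alpha> g) * character \<alpha> g = 1"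
    by (simp only: mult.commute)
qed

lemma character_minus: "character \<alpha> (- g) = cnj (character \<alpha> g)"
proof -
  have "character \<alpha> (- g) = character \<alpha> (- g) * (character \<alpha> g * cnj (character \<alpha> g))"
    by simp
  also have "\<dots> = character \<alpha> (- g + g) * cnj (character \<alpha> g)"
    by (simp only: character_add mult.assoc)
  finally show ?thesis
    by simp
qed

lemma character_diff: "character \<alpha> (g - h) = character \<alpha> g * cnj (character \<alpha> h)"
  using character_add[of \<alpha> g "- h"] by (simp add: character_minus)

section \<open>Sums over a finite group: translation, enumeration and the order of an
  element\<close>

lemma sum_translate:
  fixes f :: "'g :: {ab_group_add, finite} \<Rightarrow> 'a :: comm_monoid_add"
  shows "(\<Sum>h\<in>UNIV. f (g + h)) = (\<Sum>h\<in>UNIV. f h)"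
  by (rule sum.reindex_bij_witness[of _ "\<lambda>h. h - g" "\<lambda>h. g + h"]) auto

lemma ex_enumeration: "\<exists>e :: nat \<Rightarrow> 'a :: finite. bij_betw e {..<CARD('a)} UNIV"
  using ex_bij_betw_nat_finite[of "UNIV :: 'a set"] by (auto simp: atLeast0LessThan)

lemma sum_enumeration:
  assumes "bij_betw e {..<CARD('a)} (UNIV :: 'a set)"
  shows "(\<Sum>k<CARD('a). f (e k)) = (\<Sum>x\<in>(UNIV :: 'a :: finite set). f x)"
  using sum.reindex_bij_betw[OF assms] .

lemma enumeration_eq_iff:
  assumes "bij_betw e {..<n} A" "a < n" "b < n"
  shows "e a = e b \<longleftrightarrow> a = b"
  using assms by (auto simp: bij_betw_def inj_on_def)

text \<open>Translation by \<open>x\<close> permutes the group, so the sum of all elements equals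
  itself plus \<open>CARD('g)\<close> copies of \<open>x\<close>. Here and below, the multiple k x
  is written as a sum over \<open>i<k\<close>.\<close>

lemma sum_card_eq_0:
  fixes x :: "'g :: {ab_group_add, finite}"
  shows "(\<Sum>i<CARD('g). x) = 0"
proof -
  obtain e :: "nat \<Rightarrow> 'g" where e: "bij_betw e {..<CARD('g)} UNIV"
    using ex_enumeration by blast
  have "(\<Sum>i<CARD('g). x) = (\<Sum>h\<in>(UNIV :: 'g set). x)"
    using sum_enumeration[OF e, of "\<lambda>_. x"] .
  moreover have "(\<Sum>h\<in>(UNIV :: 'g set). x + h) = (\<Sum>h\<in>UNIV. h)"
    using sum_translate[of "\<lambda>h. h" x] by simp
  ultimately show ?thesis
    by (simp add: sum.distrib)
qed

text \<open>
  The common eigenfunction is built one translation \<open>x\<close> at a time: \<open>\<phi>\<close> is replaced by the sum of the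
  translates of \<open>\<phi>\<close> by multiples of \<open>x\<close> weighted by the powers of a root of unity \<open>z\<close>. As a
  polynomial in \<open>z\<close> this has degree less than the order of the group, so that it does not vanish at
  all roots of unity. The second condition is inherited by linear combinations of translates; it will
  exclude the eigenvalue 1 for the translation by \<open>g\<close>.
\<close>

lemma common_eigenfunction:
  fixes \<phi> :: "'g :: {ab_group_add, finite} \<Rightarrow> complex"
  assumes \<phi>: "\<phi> \<noteq> (\<lambda>_. 0)" "\<And>y. (\<Sum>k<CARD('g). \<phi> (y + (\<Sum>i<k. g))) = 0"
  assumes "finite X"
  shows "\<exists>\<phi>. \<phi> \<noteq> (\<lambda>_. 0) \<and> (\<forall>y. (\<Sum>k<CARD('g). \<phi> (y + (\<Sum>i<k. g))) = 0) \<and>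
    (\<forall>x\<in>X. \<exists>c. \<forall>y :: 'g. \<phi> (y + x) = c * (\<phi> y :: complex))"
  using \<open>finite X\<close>
proof (induction rule: finite_induct)
  case empty
  then show ?case using \<phi> by auto
next
  case (insert x X)
  then obtain f :: "'g \<Rightarrow> complex" where nz: "f \<noteq> (\<lambda>_. 0)"
    and g0: "\<And>y. (\<Sum>k<CARD('g). f (y + (\<Sum>i<k. g))) = 0"
    and X: "\<forall>x\<in>X. \<exists>c. \<forall>y. f (y + x) = c * f y" by blast
  from nz obtain y0 where y0: "f y0 \<noteq> 0" by (auto simp: fun_eq_iff)
  define N where "N = CARD('g) - 1"
  have N: "CARD('g) = Suc N" by (simp add: N_def)
  define F where "F z y = (\<Sum>k<CARD('g). z ^ k * f (y - (\<Sum>i<k. x)))" for z y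
  have "\<exists>z. z ^ CARD('g) = 1 \<and> F z y0 \<noteq> 0"
  proof (rule ccontr)
    assume "\<not> ?thesis"
    then have sub: "{z. z ^ CARD('g) = 1} \<subseteq> {z. (\<Sum>i\<le>N. f (y0 - (\<Sum>j<i. x)) * z ^ i) = 0}"
      by (auto simp: F_def N lessThan_Suc_atMost mult.commute)
    \<comment> \<open>The constant coefficient is \<open>f y0\<close>, so the polynomial is nonzero
      and has at most \<open>N\<close> roots, one fewer than there are roots of unity.\<close>
    have "\<exists>k. k \<le> N \<and> f (y0 - (\<Sum>j<k. x)) \<noteq> 0"
      using y0 by (intro exI[of _ 0]) simp
    note polyfun_rootbound[where n = N and c = "\<lambda>i. f (y0 - (\<Sum>j<i. x))", OF this]
    with card_mono[OF _ sub] have "card {z :: complex. z ^ CARD('g) = 1} \<le> N" by linarith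
    moreover have "card {z :: complex. z ^ CARD('g) = 1} = CARD('g)"
      by (rule card_roots_unity_eq) (simp add: N)
    ultimately show False by (simp add: N)
  qed
  then obtain z where z: "z ^ CARD('g) = 1" "F z y0 \<noteq> 0" by blast
  \<comment> \<open>Adding \<open>x\<close> to the argument shifts the summation index by one. The
    sum wraps around: \<open>z ^ CARD('g) = 1\<close> and \<open>CARD('g)\<close> copies of
    \<open>x\<close> add up to 0, so the term at \<open>CARD('g)\<close> equals the term at
    0.\<close>
  have "F z (y + x) = z * F z y" for y
  proof -
    let ?t = "\<lambda>k. z ^ k * f (y + x - (\<Sum>i<k. x))"
    have "sum ?t {..<CARD('g)} = sum ?t {..<Suc (CARD('g))} - ?t (CARD('g))" by simp
    also have "\<dots> = ?t 0 + (\<Sum>k<CARD('g). ?t (Suc k)) - ?t (CARD('g))"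
      by (subst sum.lessThan_Suc_shift) simp
    also have "?t (CARD('g)) = ?t 0" by (simp add: sum_card_eq_0 z)
    also have "?t 0 + (\<Sum>k<CARD('g). ?t (Suc k)) - ?t 0 = z * F z y"
      by (simp add: F_def sum_distrib_left mult.assoc)
    finally show ?thesis by (simp add: F_def)
  qed
  moreover have "\<exists>c. \<forall>y. F z (y + u) = c * F z y" if "u \<in> X" for u
  proof -
    from X that obtain c where c: "\<And>y. f (y + u) = c * f y" by blast
    have "F z (y + u) = c * F z y" for y
    proof -
      have "f (y + u - s) = c * f (y - s)" for s using c[of "y - s"] by (simp add: algebra_simps)
      then show ?thesis by (simp add: F_def sum_distrib_left mult.left_commute)
    qed
    then show ?thesis by blast
  qed
  moreover have "(\<Sum>k<CARD('g). F z (y + (\<Sum>i<k. g))) = 0" for y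
  proof -
    have "(\<Sum>k<CARD('g). F z (y + (\<Sum>i<k. g))) =
        (\<Sum>l<CARD('g). z ^ l * (\<Sum>k<CARD('g). f (y - (\<Sum>i<l. x) + (\<Sum>i<k. g))))"
      unfolding F_def sum_distrib_left by (subst sum.swap) (simp add: add_diff_eq diff_add_eq)
    also have "\<dots> = 0" by (simp add: g0)
    finally show ?thesis .
  qed
  moreover have "F z \<noteq> (\<lambda>_. 0)"
    using z(2) by metis
  ultimately show ?case
    by (intro exI[of _ "F z"]) simp
qed

text \<open>The function with value 1 at \<open>g\<close> and -1 at 0 has telescoping sums along the
  multiples of \<open>g\<close>, and these vanish because the multiples close up. The eigenvalues of
  a common eigenfunction with the same property form a character. If its value at \<open>g\<close>
  were 1, the eigenfunction would be constant along the multiples of \<open>g\<close> and those sums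
  could not all vanish.\<close>

lemma ex_separating_character:
  fixes g :: "'g :: {ab_group_add, finite}"
  assumes "g \<noteq> 0"
  shows "\<exists>\<alpha>. character \<alpha> g \<noteq> 1"
proof -
  let ?\<phi> = "\<lambda>y. of_bool (y = g) - of_bool (y = 0) :: complex"
  have "(\<Sum>k<CARD('g). ?\<phi> (y + (\<Sum>i<k. g))) = 0" for y
  proof -
    let ?d = "\<lambda>k :: nat. of_bool (y + (\<Sum>i<k. g) = g) :: complex"
    have "(\<Sum>k<CARD('g). ?\<phi> (y + (\<Sum>i<k. g))) = (\<Sum>k<CARD('g). ?d k - ?d (Suc k))"
      by (intro sum.cong) (auto simp: algebra_simps)
    also have "\<dots> = ?d 0 - ?d (CARD('g))" using sum_lessThan_telescope'[of ?d] .
    finally show ?thesis by (simp add: sum_card_eq_0)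
  qed
  moreover have "?\<phi> \<noteq> (\<lambda>_. 0)"
  proof
    assume "?\<phi> = (\<lambda>_. 0)"
    from fun_cong[OF this, of g] assms show False by simp
  qed
  ultimately have "\<exists>f. f \<noteq> (\<lambda>_. 0) \<and> (\<forall>y. (\<Sum>k<CARD('g). f (y + (\<Sum>i<k. g))) = 0) \<and>
      (\<forall>x\<in>UNIV. \<exists>c. \<forall>y :: 'g. f (y + x) = c * (f y :: complex))"
    by (intro common_eigenfunction) simp_all
  then obtain f :: "'g \<Rightarrow> complex" where f: "f \<noteq> (\<lambda>_. 0)"
    "\<And>y. (\<Sum>k<CARD('g). f (y + (\<Sum>i<k. g))) = 0" "\<And>x. \<exists>c. \<forall>y. f (y + x) = c * f y"
    by blast
  from f(3) obtain c where c: "\<And>x y. f (y + x) = c x * f y" by metis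
  from f(1) obtain y where y: "f y \<noteq> 0" by (auto simp: fun_eq_iff)
  \<comment> \<open>The nonzero value \<open>f y\<close> can be cancelled, which makes the
    eigenvalues multiplicative; the finite order of \<open>x\<close> then forces \<open>c x\<close>
    to be a root of unity.\<close>
  have mult: "c (a + b) = c a * c b" for a b
    using c[of y "a + b"] c[of "y + a" b] c[of y a] y by (simp add: add.assoc)
  have one: "c 0 = 1" using c[of y 0] y by simp
  have pow: "c (\<Sum>i<k. x) = c x ^ k" for k :: nat and x
    by (induction k) (simp_all add: one mult)
  have "cmod (c x) = 1" for x
  proof -
    have "c x ^ CARD('g) = 1" using pow[of x "CARD('g)"] by (simp add: sum_card_eq_0 one)
    then have "cmod (c x) ^ CARD('g) = 1" by (metis norm_one norm_power)
    then show ?thesis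
      using power_eq_imp_eq_base[of "cmod (c x)" "CARD('g)" 1] by simp
  qed
  then have "character (Abs_pontryagin_dual c) = c"
    by (intro Abs_pontryagin_dual_inverse) (auto simp: mult)
  moreover have "c g \<noteq> 1"
  proof
    assume "c g = 1"
    then have "(\<Sum>k<CARD('g). f (y + (\<Sum>i<k. g))) = of_nat CARD('g) * f y"
      by (simp add: c pow)
    with f(2)[of y] y show False by simp
  qed
  ultimately show ?thesis by metis
qed

section \<open>Orthogonality relations on the group and on its dual\<close>

lemma eq_0_if_eq_mult:
  fixes x :: complex
  assumes "x = c * x" "c \<noteq> 1"
  shows "x = 0"
  using assms by (metis mult_cancel_right1)

text \<open>If the characters differ at \<open>h\<close>, translating the summation variable by
  \<open>h\<close> multiplies the sum by a factor other than 1.\<close>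

lemma sum_character:
  fixes \<alpha> \<beta> :: "'g :: {ab_group_add, finite} pontryagin_dual"
  shows "(\<Sum>g\<in>UNIV. cnj (character \<alpha> g) * character \<beta> g) = (if \<alpha> = \<beta> then of_nat CARD('g) else 0)"
proof (cases "\<alpha> = \<beta>")
  case False
  then obtain h where h: "character \<alpha> h \<noteq> character \<beta> h"
    by (metis character_inject ext)
  let ?S = "\<Sum>g\<in>UNIV. cnj (character \<alpha> g) * character \<beta> g"
  have "?S = (\<Sum>g\<in>UNIV. cnj (character \<alpha> (h + g)) * character \<beta> (h + g))"
    by (rule sum_translate[symmetric])
  also have "\<dots> = cnj (character \<alpha> h) * character \<beta> h * ?S"
    by (simp add: character_add sum_distrib_left mult.assoc mult.left_commute)
  finally have "?S = cnj (character \<alpha> h) * character \<beta> h * ?S" .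
  moreover have "cnj (character \<alpha> h) * character \<beta> h \<noteq> 1"
  proof
    assume "cnj (character \<alpha> h) * character \<beta> h = 1"
    then have "character \<alpha> h * cnj (character \<alpha> h) * character \<beta> h = character \<alpha> h"
      by (metis mult.assoc mult_1_right)
    with h show False by (metis character_mult_cnj(1) mult_1)
  qed
  ultimately have "?S = 0" by (rule eq_0_if_eq_mult)
  with False show ?thesis by simp
next
  case True
  then show ?thesis by simp
qed

text \<open>Multiplication by a character \<beta> that separates \<open>g\<close> from 0 permutes
  the dual and multiplies the sum by \<open>character \<beta> g\<close>.\<close>

lemma sum_dual_character_0:
  fixes g :: "'g :: {ab_group_add, finite}"
  assumes "g \<noteq> 0"
  shows "(\<Sum>\<alpha>\<in>UNIV. character \<alpha> g) = 0"
proof -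
  from ex_separating_character[OF assms] obtain \<beta> where \<beta>: "character \<beta> g \<noteq> 1" by blast
  \<comment> \<open>The first argument is a plain function, so that the same operation also covers
    the inverse permutation, multiplication by the conjugate of \<beta>.\<close>
  define mul :: "_ \<Rightarrow> 'g pontryagin_dual \<Rightarrow> 'g pontryagin_dual"
    where "mul \<gamma> \<alpha> = Abs_pontryagin_dual (\<lambda>h. \<gamma> h * character \<alpha> h)" for \<gamma> \<alpha>
  have mul: "character (mul (character \<gamma>) \<alpha>) h = character \<gamma> h * character \<alpha> h"
    "character (mul (\<lambda>h. cnj (character \<gamma> h)) \<alpha>) h = cnj (character \<gamma> h) * character \<alpha> h" for \<gamma> \<alpha> h
    unfolding mul_def
    by (subst Abs_pontryagin_dual_inverse; simp add: norm_mult character_add)+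
  have "(\<Sum>\<alpha>\<in>UNIV. character \<alpha> g) = (\<Sum>\<alpha>\<in>UNIV. character (mul (character \<beta>) \<alpha>) g)"
    by (rule sum.reindex_bij_witness[of _ "mul (character \<beta>)" "mul (\<lambda>h. cnj (character \<beta> h))"])
      (auto simp: character_inject[symmetric] mul mult.assoc[symmetric])
  also have "\<dots> = character \<beta> g * (\<Sum>\<alpha>\<in>UNIV. character \<alpha> g)"
    by (simp add: mul sum_distrib_left)
  finally show ?thesis using \<beta> by (rule eq_0_if_eq_mult)
qed

text \<open>Double counting of the sum of \<open>character \<alpha> g\<close> over all pairs: after
  summation over \<alpha> only \<open>g = 0\<close> contributes, after summation over
  \<open>g\<close> only the trivial character.\<close>

lemma card_pontryagin_dual: "CARD('g :: {ab_group_add, finite} pontryagin_dual) = CARD('g)"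
proof -
  let ?triv = "Abs_pontryagin_dual (\<lambda>_ :: 'g. 1)"
  have triv: "character ?triv = (\<lambda>_. 1)" by (rule Abs_pontryagin_dual_inverse) auto
  have row: "(\<Sum>g\<in>UNIV. character \<alpha> g) = (if \<alpha> = ?triv then of_nat CARD('g) else 0)" for \<alpha>
    using sum_character[of ?triv \<alpha>] by (auto simp: triv)
  have "(of_nat CARD('g pontryagin_dual) :: complex) =
      (\<Sum>g\<in>(UNIV :: 'g set). if g = 0 then of_nat CARD('g pontryagin_dual) else 0)"
    by simp
  also have "\<dots> = (\<Sum>g\<in>UNIV. \<Sum>\<alpha>\<in>UNIV. character \<alpha> (g :: 'g))"
    by (intro sum.cong) (auto simp: sum_dual_character_0)
  also have "\<dots> = (\<Sum>\<alpha>\<in>UNIV. \<Sum>g\<in>UNIV. character \<alpha> (g :: 'g))" by (rule sum.swap)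
  also have "\<dots> = of_nat CARD('g)" by (simp add: row)
  finally show ?thesis by (simp only: of_nat_eq_iff)
qed

lemma sum_dual_character:
  fixes g h :: "'g :: {ab_group_add, finite}"
  shows "(\<Sum>\<alpha>\<in>UNIV. character \<alpha> g * cnj (character \<alpha> h)) = (if g = h then of_nat CARD('g) else 0)"
  using sum_dual_character_0[of "g - h"]
  by (auto simp: character_diff[symmetric] card_pontryagin_dual)

section \<open>The Fourier transform\<close>

lemma sum_UNIV_prod:
  fixes f :: "'a :: finite \<times> 'b :: finite \<Rightarrow> 'c :: comm_monoid_add"
  shows "sum f UNIV = (\<Sum>a\<in>UNIV. \<Sum>b\<in>UNIV. f (a, b))"
  unfolding UNIV_Times_UNIV[symmetric] sum.cartesian_product by simp

lemma of_real_sqrt_mult_self: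
  assumes "0 \<le> x"
  shows "complex_of_real (sqrt x) * complex_of_real (sqrt x) = of_real x"
  using assms by (simp flip: of_real_mult)

lemma of_real_sqrt_of_nat_mult_self:
  "complex_of_real (sqrt (real n)) * complex_of_real (sqrt (real n)) = of_nat n"
  by (simp add: of_real_sqrt_mult_self)

text \<open>The adjoint of the unitary matrix \<open>fourier_matrix\<close>, as an explicit
  candidate for its inverse.\<close>

definition inverse_fourier_matrix :: "complex ^ ('g pontryagin_dual) ^ ('g :: {ab_group_add, finite})" where
  "inverse_fourier_matrix = (\<chi> g \<alpha>. character \<alpha> g / complex_of_real (sqrt (real CARD('g))))"

text \<open>One product is orthogonality over the group, the other orthogonality over the
  dual.\<close>

lemma fourier_matrix_inverse:
  "fourier_matrix ** inverse_fourier_matrix =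
    (mat 1 :: ('g :: {ab_group_add, finite}) pontryagin_dual square)"
  "inverse_fourier_matrix ** fourier_matrix = (mat 1 :: ('g :: {ab_group_add, finite}) square)"
  by (simp_all add: Finite_Cartesian_Product.vec_eq_iff matrix_matrix_mult_def fourier_matrix_def inverse_fourier_matrix_def
      Finite_Cartesian_Product.mat_def of_real_sqrt_of_nat_mult_self sum_character sum_dual_character
      if_distrib[of "\<lambda>z. z / _"] flip: sum_divide_distrib cong: if_cong)

text \<open>Since \<open>matrix_inv\<close> is defined by choice, it is identified through the
  uniqueness of a two-sided inverse.\<close>

lemma matrix_inv_fourier_matrix:
  "matrix_inv (fourier_matrix :: complex ^ ('g :: {ab_group_add, finite}) ^ ('g pontryagin_dual)) =
    inverse_fourier_matrix"
  unfolding matrix_inv_def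
proof (rule some_equality)
  fix B
  assume "fourier_matrix ** B = mat 1 \<and> B ** fourier_matrix = mat 1"
  then have "(inverse_fourier_matrix ** fourier_matrix) ** B = inverse_fourier_matrix"
    by (simp flip: matrix_mul_assoc)
  then show "B = inverse_fourier_matrix"
    by (simp add: fourier_matrix_inverse)
qed (simp add: fourier_matrix_inverse)

lemma fourier_conj_nth:
  fixes A :: "('g :: {ab_group_add, finite}) square"
  shows "fourier_conj A $ \<alpha> $ \<beta> =
    (\<Sum>g\<in>UNIV. \<Sum>h\<in>UNIV. cnj (character \<alpha> g) * A $ g $ h * character \<beta> h) / of_nat CARD('g)"
proof -
  have "fourier_conj A $ \<alpha> $ \<beta> = (\<Sum>h\<in>UNIV. \<Sum>g\<in>UNIV.
      cnj (character \<alpha> g) / complex_of_real (sqrt (real CARD('g))) * A $ g $ h *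
      (character \<beta> h / complex_of_real (sqrt (real CARD('g)))))"
    unfolding fourier_conj_def matrix_inv_fourier_matrix
    by (simp add: matrix_matrix_mult_def
        fourier_matrix_def inverse_fourier_matrix_def sum_distrib_right sum_divide_distrib)
  then show ?thesis
    by (subst sum.swap) (simp add: sum_divide_distrib of_real_sqrt_of_nat_mult_self)
qed

text \<open>Fourier inversion: conjugating back recovers \<open>A\<close>, and the two square roots
  merge into one factor \<open>CARD('g)\<close>.\<close>

lemma nth_eq_sum_fourier_conj:
  fixes A :: "('g :: {ab_group_add, finite}) square"
  shows "A $ g $ h =
    (\<Sum>\<alpha>\<in>UNIV. \<Sum>\<beta>\<in>UNIV. character \<alpha> g * fourier_conj A $ \<alpha> $ \<beta> * cnj (character \<beta> h)) /
    of_nat CARD('g)"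
proof -
  have "inverse_fourier_matrix ** fourier_conj A ** fourier_matrix =
      (inverse_fourier_matrix ** fourier_matrix) ** A ** (inverse_fourier_matrix ** fourier_matrix)"
    unfolding fourier_conj_def matrix_inv_fourier_matrix by (simp only: matrix_mul_assoc)
  then have "A = inverse_fourier_matrix ** fourier_conj A ** fourier_matrix"
    by (simp add: fourier_matrix_inverse)
  then have "A $ g $ h = (inverse_fourier_matrix ** fourier_conj A ** fourier_matrix) $ g $ h"
    by simp
  also have "\<dots> = (\<Sum>\<beta>\<in>UNIV. \<Sum>\<alpha>\<in>UNIV.
      character \<alpha> g / complex_of_real (sqrt (real CARD('g))) * fourier_conj A $ \<alpha> $ \<beta> *
      (cnj (character \<beta> h) / complex_of_real (sqrt (real CARD('g)))))"
    by (simp add: matrix_matrix_mult_def fourier_matrix_def inverse_fourier_matrix_def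
        sum_distrib_right sum_divide_distrib)
  finally show ?thesis
    by (subst sum.swap) (simp add: sum_divide_distrib of_real_sqrt_of_nat_mult_self)
qed

lemma nth_eq_sum_if_diagonal:
  fixes A :: "('g :: {ab_group_add, finite}) square"
  assumes "diagonal (fourier_conj A)"
  shows "A $ g $ h =
    (\<Sum>\<alpha>\<in>UNIV. fourier_conj A $ \<alpha> $ \<alpha> * (character \<alpha> g * cnj (character \<alpha> h))) / of_nat CARD('g)"
proof -
  have "(\<Sum>\<beta>\<in>UNIV. character \<alpha> g * fourier_conj A $ \<alpha> $ \<beta> * cnj (character \<beta> h)) =
      fourier_conj A $ \<alpha> $ \<alpha> * (character \<alpha> g * cnj (character \<alpha> h))" for \<alpha>
  proof -
    have "(\<Sum>\<beta>\<in>UNIV. character \<alpha> g * fourier_conj A $ \<alpha> $ \<beta> * cnj (character \<beta> h)) =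
        (\<Sum>\<beta>\<in>{\<alpha>}. character \<alpha> g * fourier_conj A $ \<alpha> $ \<beta> * cnj (character \<beta> h))"
      by (rule sum.mono_neutral_right) (use assms in \<open>auto simp: diagonal_def\<close>)
    then show ?thesis by (simp add: mult.assoc mult.left_commute)
  qed
  then show ?thesis
    by (subst nth_eq_sum_fourier_conj) simp
qed

text \<open>For a stable block, \<open>A $ g $ (g + h)\<close> depends on \<open>h\<close> alone, so
  the substitution of \<open>g + h\<close> for \<open>h\<close> splits off the inner product of
  \<alpha> and \<beta>, which is 0 for distinct characters. Conversely, a diagonal transform makes
  the entries combinations of the values of characters at \<open>g - h\<close>.\<close>

lemma group_stable_iff_diagonal:
  fixes A :: "('g :: {ab_group_add, finite}) square"
  shows "group_stable A \<longleftrightarrow> diagonal (fourier_conj A)"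
proof
  assume stable: "group_stable A"
  have "fourier_conj A $ \<alpha> $ \<beta> = 0" if "\<alpha> \<noteq> \<beta>" for \<alpha> \<beta>
  proof -
    have A: "A $ g $ (g + h) = A $ 0 $ h" for g h
      using stable unfolding group_stable_def by (metis add.right_neutral)
    have "(\<Sum>g\<in>UNIV. \<Sum>h\<in>UNIV. cnj (character \<alpha> g) * A $ g $ h * character \<beta> h) =
        (\<Sum>g\<in>UNIV. \<Sum>h\<in>UNIV. cnj (character \<alpha> g) * A $ g $ (g + h) * character \<beta> (g + h))"
      by (intro sum.cong refl sum_translate[symmetric])
    also have "\<dots> = (\<Sum>g\<in>UNIV. \<Sum>h\<in>UNIV.
        (cnj (character \<alpha> g) * character \<beta> g) * (A $ 0 $ h * character \<beta> h))"
      by (intro sum.cong refl) (simp add: A character_add)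
    also have "\<dots> = (\<Sum>g\<in>UNIV. cnj (character \<alpha> g) * character \<beta> g) *
        (\<Sum>h\<in>UNIV. A $ 0 $ h * character \<beta> h)"
      by (rule sum_product[symmetric])
    finally show ?thesis
      using that by (simp add: fourier_conj_nth sum_character)
  qed
  then show "diagonal (fourier_conj A)"
    by (simp add: diagonal_def)
next
  assume diag: "diagonal (fourier_conj A)"
  have "character \<alpha> (k + g) * cnj (character \<alpha> (k + h)) = character \<alpha> g * cnj (character \<alpha> h)"
    for \<alpha> and k g h :: 'g
    by (simp flip: character_diff)
  then show "group_stable A"
    by (simp add: group_stable_def nth_eq_sum_if_diagonal[OF diag])
qed

lemma fourier_slice_nth:
  fixes G :: "('t :: finite \<times> 'g :: {ab_group_add, finite}) square"
  shows "fourier_slice G \<alpha> $ i $ j =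
    (\<Sum>g\<in>UNIV. \<Sum>h\<in>UNIV. cnj (character \<alpha> g) * G $ (i, g) $ (j, h) * character \<alpha> h) / of_nat CARD('g)"
  by (simp add: fourier_slice_def fourier_conj_nth block_def)

lemma nth_eq_sum_fourier_slice:
  fixes G :: "('t :: finite \<times> 'g :: {ab_group_add, finite}) square"
  assumes "\<And>i j. diagonal (fourier_conj (block G i j))"
  shows "G $ (i, g) $ (j, h) =
    (\<Sum>\<alpha>\<in>UNIV. fourier_slice G \<alpha> $ i $ j * (character \<alpha> g * cnj (character \<alpha> h))) / of_nat CARD('g)"
  using nth_eq_sum_if_diagonal[OF assms, of i j g h] by (simp add: fourier_slice_def block_def)

section \<open>Positive semidefinite matrices\<close>

text \<open>The arguments are plain functions, so that test vectors can be written down and changed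
  in one coordinate directly.\<close>

definition quad :: "('n :: finite) square \<Rightarrow> ('n \<Rightarrow> complex) \<Rightarrow> complex" where
  "quad A x = (\<Sum>i\<in>UNIV. \<Sum>j\<in>UNIV. cnj (x i) * A $ i $ j * x j)"

lemma psd_iff_quad:
  "psd A \<longleftrightarrow> (\<forall>i j. A $ i $ j = cnj (A $ j $ i)) \<and> (\<forall>x. 0 \<le> Re (quad A x))"
proof -
  have eq: "(\<Sum>i\<in>UNIV. cnj (v $ i) * (A *v v) $ i) = quad A (\<lambda>i. v $ i)" for v
    by (simp add: quad_def matrix_vector_mult_def sum_distrib_left mult.assoc)
  have "(\<forall>v. 0 \<le> Re (quad A (\<lambda>i. v $ i))) \<longleftrightarrow> (\<forall>x. 0 \<le> Re (quad A x))"
  proof safe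
    fix x
    assume "\<forall>v. 0 \<le> Re (quad A (\<lambda>i. v $ i))"
    from this[rule_format, of "\<chi> i. x i"] show "0 \<le> Re (quad A x)"
      by (simp add: vec_lambda_inverse)
  qed simp
  then show ?thesis
    by (simp add: psd_def eq)
qed

lemma psd_sym: "psd A \<Longrightarrow> cnj (A $ i $ j) = A $ j $ i"
  by (metis psd_def)

text \<open>Once the sums are exchanged, the quadratic form is a sum of squared moduli.\<close>

lemma psd_if_gram:
  assumes "finite S" and gram: "\<And>p q. A $ p $ q = (\<Sum>a\<in>S. cnj (w p a) * w q a)"
  shows "psd A"
  unfolding psd_iff_quad
proof safe
  show "A $ i $ j = cnj (A $ j $ i)" for i j
    by (simp add: gram mult.commute)
  show "0 \<le> Re (quad A x)" for x
  proof -
    have "quad A x = (\<Sum>i\<in>UNIV. \<Sum>a\<in>S. \<Sum>j\<in>UNIV. (cnj (w i a) * cnj (x i)) * (w j a * x j))"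
      unfolding quad_def gram sum_distrib_left sum_distrib_right
      by (intro sum.cong refl, subst sum.swap, intro sum.cong refl) (simp add: mult_ac)
    also have "\<dots> = (\<Sum>a\<in>S. \<Sum>i\<in>UNIV. \<Sum>j\<in>UNIV. (cnj (w i a) * cnj (x i)) * (w j a * x j))"
      by (rule sum.swap)
    also have "\<dots> = (\<Sum>a\<in>S. cnj (\<Sum>j\<in>UNIV. w j a * x j) * (\<Sum>j\<in>UNIV. w j a * x j))"
      by (simp add: sum_product)
    also have "\<dots> = (\<Sum>a\<in>S. of_real ((cmod (\<Sum>j\<in>UNIV. w j a * x j))\<^sup>2))"
      by (intro sum.cong refl) (simp only: complex_norm_square mult.commute)
    also have "Re \<dots> \<ge> 0"
      by (simp add: sum_nonneg flip: of_real_power)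
    finally show ?thesis .
  qed
qed

text \<open>This expansion, in which \<open>s y i\<close> is entry \<open>i\<close> of A y, yields
  the sign of the diagonal entries, the vanishing of rows with zero pivot, and the completion of the
  square for Schur complements.\<close>

lemma quad_add_unit:
  assumes herm: "\<And>i j. cnj (A $ i $ j) = A $ j $ i"
  defines "s y i \<equiv> \<Sum>q\<in>UNIV. A $ i $ q * y q"
  shows "quad A (\<lambda>k. y k + (if k = i then c else 0)) =
    quad A y + cnj c * s y i + cnj (s y i) * c + cnj c * c * A $ i $ i"
proof -
  let ?e = "\<lambda>k. if k = i then c else 0"
  have "(\<Sum>p\<in>UNIV. \<Sum>q\<in>UNIV. cnj (y p) * A $ p $ q * ?e q) = (\<Sum>p\<in>UNIV. cnj (y p) * A $ p $ i * c)"
    by (simp add: if_distrib[of "\<lambda>z. _ * z"] cong: if_cong)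
  also have "\<dots> = cnj (s y i) * c"
    unfolding s_def sum_distrib_right cnj_sum by (intro sum.cong refl) (simp add: herm)
  finally have right: "(\<Sum>p\<in>UNIV. \<Sum>q\<in>UNIV. cnj (y p) * A $ p $ q * ?e q) = cnj (s y i) * c" .
  have "quad A (\<lambda>k. y k + ?e k) = quad A y
      + (\<Sum>p\<in>UNIV. \<Sum>q\<in>UNIV. cnj (?e p) * (A $ p $ q * y q))
      + (\<Sum>p\<in>UNIV. \<Sum>q\<in>UNIV. cnj (y p) * A $ p $ q * ?e q)
      + (\<Sum>p\<in>UNIV. \<Sum>q\<in>UNIV. cnj (?e p) * (A $ p $ q * ?e q))"
    unfolding quad_def sum.distrib[symmetric]
    by (intro sum.cong refl) (simp only: complex_cnj_add algebra_simps)
  also have "(\<Sum>p\<in>UNIV. \<Sum>q\<in>UNIV. cnj (?e p) * (A $ p $ q * y q)) = cnj c * s y i"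
    unfolding s_def sum_distrib_left[symmetric]
    by (simp add: if_distrib[of cnj] if_distrib[of "\<lambda>z. z * _"] cong: if_cong)
  also have "(\<Sum>p\<in>UNIV. \<Sum>q\<in>UNIV. cnj (y p) * A $ p $ q * ?e q) = cnj (s y i) * c"
    by (rule right)
  also have "(\<Sum>p\<in>UNIV. \<Sum>q\<in>UNIV. cnj (?e p) * (A $ p $ q * ?e q)) = cnj c * c * A $ i $ i"
    unfolding sum_distrib_left[symmetric]
    by (simp add: if_distrib[of cnj] if_distrib[of "\<lambda>z. z * _"] if_distrib[of "\<lambda>z. _ * z"] cong: if_cong)
  finally show ?thesis .
qed

lemma psd_diagonal:
  assumes "psd A"
  shows "A $ i $ i = of_real (Re (A $ i $ i))" "0 \<le> Re (A $ i $ i)"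
proof -
  show "A $ i $ i = of_real (Re (A $ i $ i))"
    using psd_sym[OF assms, of i i] by (simp add: complex_eq_iff)
  \<comment> \<open>The leading zero gives the unit vector the shape that
    \<open>quad_add_unit\<close> expects.\<close>
  have "quad A (\<lambda>k. 0 + (if k = i then 1 else 0)) = A $ i $ i"
    by (subst quad_add_unit) (use psd_sym[OF assms] in \<open>simp_all add: quad_def\<close>)
  then show "0 \<le> Re (A $ i $ i)"
    using assms unfolding psd_iff_quad by metis
qed

text \<open>With a zero pivot the form has no quadratic term in coordinate \<open>i\<close>, so a
  nonzero \<open>A $ i $ j\<close> would let that coordinate drive it below zero linearly.\<close>

lemma psd_zero_diagonal:
  assumes "psd A" and "A $ i $ i = 0"
  shows "A $ i $ j = 0"
proof (rule ccontr)
  assume nz: "A $ i $ j \<noteq> 0"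
  \<comment> \<open>The value of the form will be the diagonal entry at \<open>j\<close> minus
    \<open>2 * r * (cmod (A $ i $ j))^2\<close>; this \<open>r\<close> makes its real part
    -1.\<close>
  define r where "r = (Re (A $ j $ j) + 1) / (2 * (cmod (A $ i $ j))\<^sup>2)"
  define y where "y = (\<lambda>k. 0 + (if k = j then 1 else (0 :: complex)))"
  define c where "c = - of_real r * A $ i $ j"
  have y: "quad A y = A $ j $ j"
    unfolding y_def by (subst quad_add_unit) (use psd_sym[OF assms(1)] in \<open>simp_all add: quad_def\<close>)
  have s: "(\<Sum>q\<in>UNIV. A $ i $ q * y q) = A $ i $ j"
    by (simp add: y_def if_distrib[of "\<lambda>z. _ * z"] cong: if_cong)
  have "quad A (\<lambda>k. y k + (if k = i then c else 0)) =
      A $ j $ j + cnj c * A $ i $ j + cnj (A $ i $ j) * c"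
    by (subst quad_add_unit) (use psd_sym[OF assms(1)] in \<open>simp_all add: assms(2) s y\<close>)
  also have "\<dots> = A $ j $ j - of_real (2 * r * (cmod (A $ i $ j))\<^sup>2)"
    unfolding of_real_mult complex_norm_square by (simp add: c_def algebra_simps)
  also have "Re \<dots> = - 1"
    using nz by (simp add: r_def field_simps)
  finally have "Re (quad A (\<lambda>k. y k + (if k = i then c else 0))) = - 1" .
  moreover have "0 \<le> Re (quad A (\<lambda>k. y k + (if k = i then c else 0)))"
    using assms(1) unfolding psd_iff_quad by blast
  ultimately show False by simp
qed

section \<open>Schur complements and Cholesky factorisation\<close>

definition schur_complement :: "('n :: finite) square \<Rightarrow> 'n \<Rightarrow> 'n square" where
  "schur_complement A i = (\<chi> j k. A $ j $ k - A $ j $ i * A $ i $ k / A $ i $ i)"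

text \<open>Completing the square: the form of the Schur complement at \<open>y\<close> is the form
  of \<open>A\<close> at \<open>y\<close> with coordinate \<open>i\<close> suitably changed.\<close>

lemma psd_schur_complement:
  assumes "psd A" and nz: "A $ i $ i \<noteq> 0"
  shows "psd (schur_complement A i)"
  unfolding psd_iff_quad
proof safe
  note herm = psd_sym[OF assms(1)]
  show "schur_complement A i $ j $ k = cnj (schur_complement A i $ k $ j)" for j k
    by (simp add: schur_complement_def herm mult.commute)
  show "0 \<le> Re (quad (schur_complement A i) y)" for y
  proof -
    define s where "s = (\<Sum>q\<in>UNIV. A $ i $ q * y q)"
    \<comment> \<open>This change of coordinate \<open>i\<close> minimises the form of
      \<open>A\<close>.\<close>
    define c where "c = - s / A $ i $ i"
    have "quad (schur_complement A i) y = quad A y -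
        (\<Sum>p\<in>UNIV. \<Sum>q\<in>UNIV. (cnj (y p) * A $ p $ i) * (A $ i $ q * y q)) / A $ i $ i"
      unfolding quad_def sum_divide_distrib sum_subtractf[symmetric]
      by (intro sum.cong refl) (simp add: schur_complement_def algebra_simps)
    also have "(\<Sum>p\<in>UNIV. \<Sum>q\<in>UNIV. (cnj (y p) * A $ p $ i) * (A $ i $ q * y q)) = cnj s * s"
      unfolding sum_product[symmetric] by (simp add: s_def herm mult.commute)
    also have "quad A y - cnj s * s / A $ i $ i = quad A (\<lambda>k. y k + (if k = i then c else 0))"
      unfolding quad_add_unit[of A, OF herm] s_def[symmetric]
      using nz by (simp add: c_def herm field_simps)
    finally show ?thesis
      using assms(1) unfolding psd_iff_quad by metis
  qed
qed

text \<open>Cholesky factorisation by induction on a set outside which all rows vanish. A zero pivot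
  kills its row; otherwise a rank-one summand is split off and row \<open>i\<close> of the Schur
  complement vanishes. The index type stays fixed while \<open>S\<close> shrinks.\<close>

lemma psd_imp_gram_aux:
  assumes "finite S" "psd A" "\<And>j k. j \<notin> S \<Longrightarrow> A $ j $ k = 0"
  shows "\<exists>B. \<forall>j k. A $ j $ k = (\<Sum>i\<in>S. cnj (B i j) * B i k :: complex)"
  using assms
proof (induction S arbitrary: A rule: finite_induct)
  case empty
  then show ?case by simp
next
  case (insert i S)
  note herm = psd_sym[OF insert.prems(1)]
  \<comment> \<open>Since \<open>i\<close> lies outside \<open>S\<close>, storing a new row
    \<open>b\<close> at \<open>i\<close> leaves the sum over \<open>S\<close> unchanged.\<close>
  have sum_upd: "(\<Sum>l\<in>insert i S. cnj ((B(i := b)) l j) * (B(i := b)) l k) =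
      cnj (b j) * b k + (\<Sum>l\<in>S. cnj (B l j) * B l k :: complex)" for B :: "_ \<Rightarrow> _ \<Rightarrow> complex" and b j k
  proof -
    have "(\<Sum>l\<in>S. cnj ((B(i := b)) l j) * (B(i := b)) l k) = (\<Sum>l\<in>S. cnj (B l j) * B l k)"
      using insert.hyps by (intro sum.cong) auto
    with insert.hyps show ?thesis by simp
  qed
  show ?case
  proof (cases "A $ i $ i = 0")
    case True
    then have "A $ j $ k = 0" if "j \<notin> S" for j k
      using insert.prems(2)[of j k] psd_zero_diagonal[OF insert.prems(1)] that by (cases "j = i") auto
    from insert.IH[OF insert.prems(1) this] obtain B
      where "\<forall>j k. A $ j $ k = (\<Sum>i\<in>S. cnj (B i j) * B i k)" by blast
    \<comment> \<open>The zero product is the contribution of a zero row at \<open>i\<close>, in the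
      shape of \<open>sum_upd\<close>.\<close>
    then have "A $ j $ k = cnj 0 * 0 + (\<Sum>i\<in>S. cnj (B i j) * B i k)" for j k
      by simp
    then show ?thesis
      by (intro exI[of _ "B(i := \<lambda>_. 0)"] allI) (unfold sum_upd)
  next
    case False
    define r where "r = complex_of_real (sqrt (Re (A $ i $ i)))"
    have "A $ j $ i = 0" if "j \<notin> insert i S" for j
      using insert.prems(2)[OF that] .
    then have "schur_complement A i $ j $ k = 0" if "j \<notin> S" for j k
      using insert.prems(2)[of j] that False by (cases "j = i") (auto simp: schur_complement_def)
    from insert.IH[OF psd_schur_complement[OF insert.prems(1) False] this] obtain B
      where B: "\<forall>j k. schur_complement A i $ j $ k = (\<Sum>i\<in>S. cnj (B i j) * B i k)" by blast
    have r: "r * r = A $ i $ i"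
      using psd_diagonal[OF insert.prems(1), of i] by (simp add: of_real_sqrt_mult_self r_def)
    have cnj_r: "cnj r = r"
      by (simp add: r_def)
    have "A $ j $ k = cnj (A $ i $ j / r) * (A $ i $ k / r) + (\<Sum>i\<in>S. cnj (B i j) * B i k)" for j k
      unfolding B[rule_format, symmetric] by (simp add: schur_complement_def herm r cnj_r)
    then show ?thesis
      by (intro exI[of _ "B(i := \<lambda>k. A $ i $ k / r)"] allI) (unfold sum_upd)
  qed
qed

lemma psd_imp_gram:
  assumes "psd A"
  shows "\<exists>B :: 'n \<Rightarrow> 'n \<Rightarrow> complex. \<forall>j k. A $ j $ k = (\<Sum>i\<in>(UNIV :: 'n :: finite set). cnj (B i j) * B i k)"
  using psd_imp_gram_aux[of UNIV A] assms by simp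

text \<open>The nonzero trace provides a nonzero pivot \<open>i\<close>. The condition
  \<open>square\<close> at \<open>i\<close> makes the Schur complement there traceless; being
  positive semidefinite, it is zero, so \<open>A\<close> is the rank-one matrix built from its row
  \<open>i\<close>.\<close>

lemma psd_rank_one:
  fixes A :: "('n :: finite) square"
  assumes "psd A" and trace: "(\<Sum>i\<in>UNIV. A $ i $ i) = c" and "c \<noteq> 0"
    and square: "\<And>i. (\<Sum>j\<in>UNIV. A $ i $ j * A $ j $ i) = c * A $ i $ i"
  shows "\<exists>b. \<forall>j k. A $ j $ k = cnj (b j) * b k"
proof -
  note herm = psd_sym[OF assms(1)]
  have "\<exists>i. A $ i $ i \<noteq> 0"
    using trace \<open>c \<noteq> 0\<close> by (metis (mono_tags, lifting) sum.neutral)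
  then obtain i where i: "A $ i $ i \<noteq> 0" ..
  let ?C = "schur_complement A i"
  have psd: "psd ?C" by (rule psd_schur_complement[OF assms(1) i])
  have "(\<Sum>j\<in>UNIV. ?C $ j $ j) = c - (\<Sum>j\<in>UNIV. A $ i $ j * A $ j $ i) / A $ i $ i"
    by (simp add: schur_complement_def sum_subtractf trace sum_divide_distrib mult.commute)
  also have "\<dots> = 0" using i by (simp add: square)
  finally have "(\<Sum>j\<in>UNIV. Re (?C $ j $ j)) = 0"
    by (simp flip: Re_sum)
  then have "Re (?C $ j $ j) = 0" for j
    using psd_diagonal(2)[OF psd] by (simp add: sum_nonneg_eq_0_iff)
  then have "?C $ j $ j = 0" for j
    using psd_diagonal(1)[OF psd, of j] by simp
  then have C0: "?C $ j $ k = 0" for j k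
    by (rule psd_zero_diagonal[OF psd])
  define r where "r = complex_of_real (sqrt (Re (A $ i $ i)))"
  have r: "r * r = A $ i $ i"
    using psd_diagonal[OF assms(1), of i] by (simp add: of_real_sqrt_mult_self r_def)
  have cnj_r: "cnj r = r"
    by (simp add: r_def)
  have "A $ j $ k = cnj (A $ i $ j / r) * (A $ i $ k / r)" for j k
    using C0[of j k] by (simp add: schur_complement_def herm r cnj_r)
  then show ?thesis by (intro exI[of _ "\<lambda>k. A $ i $ k / r"]) blast
qed

text \<open>The form of the slice at \<open>x\<close> is, up to the factor \<open>CARD('g)\<close>,
  the form of \<open>G\<close> at the vector with entries
  \<open>x i * character \<alpha> g\<close>.\<close>

lemma psd_fourier_slice:
  fixes G :: "('t :: finite \<times> 'g :: {ab_group_add, finite}) square"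
  assumes "psd G"
  shows "psd (fourier_slice G \<alpha>)"
  unfolding psd_iff_quad
proof safe
  note herm = psd_sym[OF assms]
  show "fourier_slice G \<alpha> $ i $ j = cnj (fourier_slice G \<alpha> $ j $ i)" for i j
    unfolding fourier_slice_nth
    by (simp add: herm mult.assoc) (subst sum.swap, simp add: mult.assoc mult.commute mult.left_commute)
  show "0 \<le> Re (quad (fourier_slice G \<alpha>) x)" for x
  proof -
    have "quad (fourier_slice G \<alpha>) x = (\<Sum>i\<in>UNIV. \<Sum>j\<in>UNIV. \<Sum>g\<in>UNIV. \<Sum>h\<in>UNIV.
        cnj (x i * character \<alpha> g) * G $ (i, g) $ (j, h) * (x j * character \<alpha> h)) / of_nat CARD('g)"
      unfolding quad_def fourier_slice_nth sum_divide_distrib sum_distrib_left sum_distrib_right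
      by (intro sum.cong refl) (simp add: mult_ac)
    also have "\<dots> = quad G (\<lambda>(i, g). x i * character \<alpha> g) / of_nat CARD('g)"
      unfolding quad_def sum_UNIV_prod by (subst sum.swap) simp
    also have "Re \<dots> \<ge> 0"
      using assms by (simp add: psd_iff_quad complex_is_Real_iff Re_divide_of_nat)
    finally show ?thesis .
  qed
qed

section \<open>Harmonic collections\<close>

lemma dim_mat_adjoint [simp]:
  "dim_row (mat_adjoint A) = dim_col A" "dim_col (mat_adjoint A) = dim_row A"
  by (simp_all add: mat_adjoint_def)

lemma index_mat_adjoint:
  assumes "i < dim_col A" "j < dim_row A"
  shows "mat_adjoint A $$ (i, j) = cnj (A $$ (j, i))"
  using assms by (simp add: mat_adjoint_def mat_of_rows_index)

lemma index_mat_adjoint_mult: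
  assumes "i < dim_col A" "j < dim_col A"
  shows "(mat_adjoint A * A) $$ (i, j) = (\<Sum>k<dim_row A. cnj (A $$ (k, i)) * A $$ (k, j))"
  using assms by (simp add: scalar_prod_def index_mat_adjoint atLeast0LessThan)

lemma index_mult_mat_vec_sum:
  assumes "A \<in> carrier_mat n d" "v \<in> carrier_vec d" "k < n"
  shows "vec_index (A *\<^sub>v v) k = (\<Sum>i<d. A $$ (k, i) * vec_index v i)"
  using assms by (auto simp: scalar_prod_def atLeast0LessThan)

lemma cscalar_prod_sum:
  assumes "v \<in> carrier_vec d" "w \<in> carrier_vec d"
  shows "v \<bullet>c w = (\<Sum>k<d. cnj (vec_index w k) * vec_index v k)"
  using assms by (auto simp: scalar_prod_def atLeast0LessThan mult.commute)

text \<open>After the sums are exchanged, the sum over the rows \<open>k\<close> is an entry of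
  \<open>mat_adjoint A * A\<close>.\<close>

lemma cscalar_prod_isometry:
  fixes A :: "complex mat"
  assumes A: "A \<in> carrier_mat d d" "mat_adjoint A * A = 1\<^sub>m d"
    and v: "v \<in> carrier_vec d" and w: "w \<in> carrier_vec d"
  shows "(A *\<^sub>v v) \<bullet>c (A *\<^sub>v w) = v \<bullet>c w"
proof -
  have one: "(\<Sum>k<d. cnj (A $$ (k, j)) * A $$ (k, i)) = (if j = i then 1 else 0)"
    if "i < d" "j < d" for i j
    using index_mat_adjoint_mult[of j A i] that A by simp
  have "(A *\<^sub>v v) \<bullet>c (A *\<^sub>v w) =
      (\<Sum>k<d. (\<Sum>j<d. cnj (A $$ (k, j) * vec_index w j)) * (\<Sum>i<d. A $$ (k, i) * vec_index v i))"
    using A v w by (simp add: cscalar_prod_sum[of _ d] index_mult_mat_vec_sum[of A d d]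
        del: index_mult_mat_vec)
  also have "\<dots> = (\<Sum>k<d. \<Sum>j<d. \<Sum>i<d.
      cnj (vec_index w j) * vec_index v i * (cnj (A $$ (k, j)) * A $$ (k, i)))"
    unfolding sum_product by (intro sum.cong refl) (simp add: mult_ac)
  also have "\<dots> = (\<Sum>j<d. \<Sum>k<d. \<Sum>i<d.
      cnj (vec_index w j) * vec_index v i * (cnj (A $$ (k, j)) * A $$ (k, i)))"
    by (rule sum.swap)
  also have "\<dots> = (\<Sum>j<d. \<Sum>i<d. \<Sum>k<d.
      cnj (vec_index w j) * vec_index v i * (cnj (A $$ (k, j)) * A $$ (k, i)))"
    by (intro sum.cong refl sum.swap)
  also have "\<dots> = (\<Sum>j<d. \<Sum>i<d. cnj (vec_index w j) * vec_index v i * (if j = i then 1 else 0))"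
    unfolding sum_distrib_left[symmetric] by (intro sum.cong refl) (simp add: one)
  also have "\<dots> = v \<bullet>c w"
    using v w by (simp add: cscalar_prod_sum[of _ d] if_distrib[of "\<lambda>z. _ * z"] cong: if_cong)
  finally show ?thesis .
qed

lemma harmonic_gram_nth:
  assumes "harmonic d \<rho> \<psi>"
  shows "harmonic_gram \<rho> \<psi> $ p $ q =
    (\<Sum>a<d. cnj (vec_index (\<rho> (snd p) *\<^sub>v \<psi> (fst p)) a) * vec_index (\<rho> (snd q) *\<^sub>v \<psi> (fst q)) a)"
proof -
  have "\<rho> g *\<^sub>v \<psi> i \<in> carrier_vec d" for g i
    using assms by (auto simp: harmonic_def unitary_rep_def intro!: mult_mat_vec_carrier)
  then show ?thesis
    by (simp add: harmonic_gram_def cscalar_prod_sum[of _ d])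
qed

lemma psd_harmonic_gram: "harmonic d \<rho> \<psi> \<Longrightarrow> psd (harmonic_gram \<rho> \<psi>)"
  by (rule psd_if_gram[OF finite_lessThan harmonic_gram_nth])

text \<open>A common shift by \<open>k\<close> applies the isometry \<open>\<rho> k\<close> to both
  vectors of the inner product.\<close>

lemma group_stable_harmonic_gram:
  fixes \<rho> :: "'g :: {ab_group_add, finite} \<Rightarrow> complex mat"
  assumes "harmonic d \<rho> \<psi>"
  shows "group_stable (block (harmonic_gram \<rho> \<psi>) i j)"
proof -
  have \<rho>: "\<And>g. \<rho> g \<in> carrier_mat d d" "\<And>g. mat_adjoint (\<rho> g) * \<rho> g = 1\<^sub>m d"
    "\<And>g h. \<rho> (g + h) = \<rho> g * \<rho> h" and \<psi>: "\<And>i. \<psi> i \<in> carrier_vec d"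
    using assms by (auto simp: harmonic_def unitary_rep_def)
  have "(\<rho> (k + h) *\<^sub>v \<psi> j) \<bullet>c (\<rho> (k + g) *\<^sub>v \<psi> i) = (\<rho> h *\<^sub>v \<psi> j) \<bullet>c (\<rho> g *\<^sub>v \<psi> i)" for k g h
  proof -
    have "\<rho> (k + g) *\<^sub>v \<psi> i = \<rho> k *\<^sub>v (\<rho> g *\<^sub>v \<psi> i)" for g i
      unfolding \<rho>(3) by (rule assoc_mult_mat_vec[OF \<rho>(1) \<rho>(1) \<psi>])
    then show ?thesis
      using cscalar_prod_isometry[OF \<rho>(1,2)] mult_mat_vec_carrier[OF \<rho>(1) \<psi>] by simp
  qed
  then show ?thesis
    by (simp add: group_stable_def block_def harmonic_gram_def)
qed

text \<open>Each slice has its own factor \<open>B \<alpha>\<close>, so the space has one coordinate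
  for every pair of a factor row and a character.\<close>

lemma ex_is_harmonic_gram:
  fixes G :: "('t :: finite \<times> 'g :: {ab_group_add, finite}) square"
  assumes diag: "\<And>i j. diagonal (fourier_conj (block G i j))"
    and psd: "\<And>\<alpha>. psd (fourier_slice G \<alpha>)"
  shows "\<exists>d \<rho>. is_harmonic_gram d \<rho> G"
proof -
  have "\<forall>\<alpha>. \<exists>B :: 't \<Rightarrow> 't \<Rightarrow> complex. \<forall>i j.
      fourier_slice G \<alpha> $ i $ j = (\<Sum>k\<in>UNIV. cnj (B k i) * B k j)"
    using psd psd_imp_gram by blast
  then obtain B :: "'g pontryagin_dual \<Rightarrow> 't \<Rightarrow> 't \<Rightarrow> complex"
    where B: "\<And>\<alpha> i j. fourier_slice G \<alpha> $ i $ j = (\<Sum>k\<in>UNIV. cnj (B \<alpha> k i) * B \<alpha> k j)"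
    by metis
  define d where "d = CARD('t \<times> 'g pontryagin_dual)"
  obtain e :: "nat \<Rightarrow> 't \<times> 'g pontryagin_dual" where e: "bij_betw e {..<d} UNIV"
    using ex_enumeration unfolding d_def by blast
  \<comment> \<open>The factor 1 / \<open>CARD('g)\<close> of the inversion formula is shared
    equally between the two vectors of each inner product.\<close>
  define r where "r = complex_of_real (sqrt (real CARD('g)))"
  have r: "r * r = of_nat CARD('g)" "cnj r = r"
    by (simp_all add: r_def of_real_sqrt_of_nat_mult_self)
  \<comment> \<open>The characters enter conjugated: the inner product conjugates its left vector,
    and the inversion formula needs \<alpha> at \<open>g\<close> and its conjugate at
    \<open>h\<close>.\<close>
  define \<rho> where "\<rho> g = Matrix.mat d d (\<lambda>(a, b). if a = b then cnj (character (snd (e a)) g) else 0)"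
    for g :: 'g
  define \<psi> where "\<psi> i = Matrix.vec d (\<lambda>a. B (snd (e a)) (fst (e a)) i / r)" for i
  have \<rho>: "\<rho> g \<in> carrier_mat d d" for g by (simp add: \<rho>_def)
  have \<psi>: "\<psi> i \<in> carrier_vec d" for i by (simp add: \<psi>_def)
  have \<rho>_nth: "\<rho> g $$ (a, b) = (if a = b then cnj (character (snd (e a)) g) else 0)"
    if "a < d" "b < d" for g a b
    using that by (simp add: \<rho>_def)
  have "mat_adjoint (\<rho> g) * \<rho> g = 1\<^sub>m d" for g
  proof (rule eq_matI)
    fix a b assume "a < dim_row (1\<^sub>m d)" "b < dim_col (1\<^sub>m d)"
    then have ab: "a < d" "b < d" by simp_all
    then have "(mat_adjoint (\<rho> g) * \<rho> g) $$ (a, b) = (\<Sum>k<d. cnj (\<rho> g $$ (k, a)) * \<rho> g $$ (k, b))"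
      using index_mat_adjoint_mult[of a "\<rho> g" b] \<rho>[of g] by simp
    also have "\<dots> = (\<Sum>k<d. if k = a then if a = b then 1 else 0 else 0)"
      using ab by (intro sum.cong refl) (auto simp: \<rho>_nth)
    also have "\<dots> = 1\<^sub>m d $$ (a, b)" using ab by simp
    finally show "(mat_adjoint (\<rho> g) * \<rho> g) $$ (a, b) = 1\<^sub>m d $$ (a, b)" .
  qed (use \<rho>[of g] in auto)
  moreover have "\<rho> (g + h) = \<rho> g * \<rho> h" for g h
  proof (rule eq_matI)
    fix a b assume "a < dim_row (\<rho> g * \<rho> h)" "b < dim_col (\<rho> g * \<rho> h)"
    then have ab: "a < d" "b < d" using \<rho>[of g] \<rho>[of h] by simp_all
    then have "(\<rho> g * \<rho> h) $$ (a, b) = (\<Sum>k<d. \<rho> g $$ (a, k) * \<rho> h $$ (k, b))"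
      using \<rho>[of g] \<rho>[of h] by (auto simp: scalar_prod_def atLeast0LessThan)
    also have "\<dots> = (\<Sum>k<d. if k = a then \<rho> (g + h) $$ (a, b) else 0)"
      using ab by (intro sum.cong refl) (auto simp: \<rho>_nth character_add)
    also have "\<dots> = \<rho> (g + h) $$ (a, b)" using ab by simp
    finally show "\<rho> (g + h) $$ (a, b) = (\<rho> g * \<rho> h) $$ (a, b)" ..
  qed (use \<rho>[of g] \<rho>[of h] \<rho>[of "g + h"] in auto)
  ultimately have harm: "harmonic d \<rho> \<psi>"
    by (simp add: harmonic_def unitary_rep_def \<rho> \<psi>)
  have act: "vec_index (\<rho> g *\<^sub>v \<psi> i) a = cnj (character (snd (e a)) g) * B (snd (e a)) (fst (e a)) i / r"
    if "a < d" for g i a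
  proof -
    have "vec_index (\<rho> g *\<^sub>v \<psi> i) a = (\<Sum>b<d. \<rho> g $$ (a, b) * vec_index (\<psi> i) b)"
      by (rule index_mult_mat_vec_sum[OF \<rho> \<psi> that])
    also have "\<dots> = (\<Sum>b<d. if b = a then cnj (character (snd (e a)) g) * B (snd (e a)) (fst (e a)) i / r else 0)"
      using that by (intro sum.cong refl) (auto simp: \<rho>_nth \<psi>_def)
    also have "\<dots> = cnj (character (snd (e a)) g) * B (snd (e a)) (fst (e a)) i / r"
      using that by simp
    finally show ?thesis .
  qed
  have "harmonic_gram \<rho> \<psi> $ (i, g) $ (j, h) = G $ (i, g) $ (j, h)" for i j g h
  proof -
    let ?f = "\<lambda>(k, \<alpha>). cnj (cnj (character \<alpha> g) * B \<alpha> k i / r) * (cnj (character \<alpha> h) * B \<alpha> k j / r)"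
    have "harmonic_gram \<rho> \<psi> $ (i, g) $ (j, h) = (\<Sum>a<d. ?f (e a))"
      unfolding harmonic_gram_nth[OF harm] by (intro sum.cong refl) (simp add: act split: prod.split)
    also have "\<dots> = sum ?f UNIV"
      using sum_enumeration[of e ?f] e by (simp only: d_def)
    also have "\<dots> = (\<Sum>\<alpha>\<in>UNIV. \<Sum>k\<in>UNIV. ?f (k, \<alpha>))"
      unfolding sum_UNIV_prod by (rule sum.swap)
    also have "\<dots> = (\<Sum>\<alpha>\<in>UNIV. fourier_slice G \<alpha> $ i $ j * (character \<alpha> g * cnj (character \<alpha> h)) / of_nat CARD('g))"
      unfolding B sum_distrib_right sum_divide_distrib
      by (intro sum.cong refl) (simp add: r mult_ac)
    also have "\<dots> = G $ (i, g) $ (j, h)"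
      unfolding nth_eq_sum_fourier_slice[OF diag] by (simp add: sum_divide_distrib)
    finally show ?thesis .
  qed
  then have nth: "G $ p $ q = harmonic_gram \<rho> \<psi> $ p $ q" for p q
    by (cases p; cases q) simp
  have "G = harmonic_gram \<rho> \<psi>"
    by (intro Finite_Cartesian_Product.vec_eq_iff[THEN iffD2] allI nth)
  with harm show ?thesis
    unfolding is_harmonic_gram_def by blast
qed

section \<open>Trace and square of the slices\<close>

lemma trace_fourier_slice:
  fixes G :: "('t :: finite \<times> 'g :: {ab_group_add, finite}) square"
  assumes "(\<Sum>i\<in>UNIV. block G i i) = real CARD('t) *\<^sub>R mat 1"
  shows "(\<Sum>i\<in>UNIV. fourier_slice G \<alpha> $ i $ i) = of_nat CARD('t)"
proof -
  have tr: "(\<Sum>i\<in>UNIV. G $ (i, g) $ (i, h)) = (if g = h then of_nat CARD('t) else 0)" for g h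
  proof -
    have "(\<Sum>i\<in>UNIV. block G i i) $ g $ h = real CARD('t) *\<^sub>R ((mat 1 :: 'g square) $ g $ h)"
      by (simp only: assms vector_scaleR_component)
    then show ?thesis
      by (simp add: block_def Finite_Cartesian_Product.mat_def scaleR_conv_of_real)
  qed
  have "(\<Sum>i\<in>UNIV. fourier_slice G \<alpha> $ i $ i) =
      (\<Sum>i\<in>UNIV. \<Sum>g\<in>UNIV. \<Sum>h\<in>UNIV. cnj (character \<alpha> g) * G $ (i, g) $ (i, h) * character \<alpha> h) / of_nat CARD('g)"
    by (simp add: fourier_slice_nth sum_divide_distrib)
  also have "(\<Sum>i\<in>UNIV. \<Sum>g\<in>UNIV. \<Sum>h\<in>UNIV. cnj (character \<alpha> g) * G $ (i, g) $ (i, h) * character \<alpha> h) =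
      (\<Sum>g\<in>UNIV. \<Sum>i\<in>UNIV. \<Sum>h\<in>UNIV. cnj (character \<alpha> g) * G $ (i, g) $ (i, h) * character \<alpha> h)"
    by (rule sum.swap)
  also have "\<dots> = (\<Sum>g\<in>UNIV. \<Sum>h\<in>UNIV. \<Sum>i\<in>UNIV. cnj (character \<alpha> g) * G $ (i, g) $ (i, h) * character \<alpha> h)"
    by (intro sum.cong refl sum.swap)
  \<comment> \<open>By \<open>tr\<close> only the pairs with \<open>g = h\<close> survive, and there
    the character values multiply to 1.\<close>
  also have "\<dots> = (\<Sum>g\<in>UNIV. \<Sum>h\<in>UNIV. if g = (h :: 'g) then of_nat CARD('t) else 0)"
    unfolding sum_distrib_right[symmetric] sum_distrib_left[symmetric] tr
    by (intro sum.cong refl) simp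
  finally show ?thesis by simp
qed

text \<open>Every block has the character \<alpha> as an eigenvector, with the matching entry of the
  slice as eigenvalue (\<open>eig\<close>). Applying both sides of \<open>square\<close> to this
  character therefore multiplies slices.\<close>

lemma square_fourier_slice:
  fixes G :: "('t :: finite \<times> 'g :: {ab_group_add, finite}) square"
  assumes diag: "\<And>i j. diagonal (fourier_conj (block G i j))"
    and square: "G ** G = c *\<^sub>R G"
  shows "(\<Sum>j\<in>UNIV. fourier_slice G \<alpha> $ i $ j * fourier_slice G \<alpha> $ j $ k) = of_real c * fourier_slice G \<alpha> $ i $ k"
proof -
  have eig: "(\<Sum>h\<in>UNIV. G $ (i, g) $ (j, h) * character \<alpha> h) = fourier_slice G \<alpha> $ i $ j * character \<alpha> g"
    for i j g
  proof -
    have "(\<Sum>h\<in>UNIV. G $ (i, g) $ (j, h) * character \<alpha> h) =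
        (\<Sum>h\<in>UNIV. \<Sum>\<beta>\<in>UNIV. fourier_slice G \<beta> $ i $ j * character \<beta> g / of_nat CARD('g) *
          (cnj (character \<beta> h) * character \<alpha> h))"
      unfolding nth_eq_sum_fourier_slice[OF diag] sum_divide_distrib sum_distrib_right
      by (intro sum.cong refl) simp
    also have "\<dots> = (\<Sum>\<beta>\<in>UNIV. \<Sum>h\<in>UNIV. fourier_slice G \<beta> $ i $ j * character \<beta> g / of_nat CARD('g) *
          (cnj (character \<beta> h) * character \<alpha> h))"
      by (rule sum.swap)
    also have "\<dots> = (\<Sum>\<beta>\<in>UNIV. if \<beta> = \<alpha> then fourier_slice G \<beta> $ i $ j * character \<beta> g else 0)"
      unfolding sum_distrib_left[symmetric] sum_character by (intro sum.cong refl) simp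
    finally show ?thesis by simp
  qed
  have prod: "of_real c * G $ (i, g) $ (k, l) =
      (\<Sum>j\<in>UNIV. \<Sum>h\<in>UNIV. G $ (i, g) $ (j, h) * G $ (j, h) $ (k, l))" for g l
  proof -
    have "(G ** G) $ (i, g) $ (k, l) = c *\<^sub>R (G $ (i, g) $ (k, l))"
      by (simp only: square vector_scaleR_component)
    then show ?thesis
      by (simp add: matrix_matrix_mult_def sum_UNIV_prod scaleR_conv_of_real)
  qed
  have inner: "(\<Sum>l\<in>UNIV. of_real c * G $ (i, g) $ (k, l) * character \<alpha> l) =
      (\<Sum>j\<in>UNIV. fourier_slice G \<alpha> $ i $ j * fourier_slice G \<alpha> $ j $ k) * character \<alpha> g" for g
  proof -
    have "(\<Sum>l\<in>UNIV. of_real c * G $ (i, g) $ (k, l) * character \<alpha> l) =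
        (\<Sum>l\<in>UNIV. \<Sum>j\<in>UNIV. \<Sum>h\<in>UNIV. G $ (i, g) $ (j, h) * (G $ (j, h) $ (k, l) * character \<alpha> l))"
      unfolding prod sum_distrib_right by (simp add: mult.assoc)
    also have "\<dots> = (\<Sum>j\<in>UNIV. \<Sum>l\<in>UNIV. \<Sum>h\<in>UNIV. G $ (i, g) $ (j, h) * (G $ (j, h) $ (k, l) * character \<alpha> l))"
      by (rule sum.swap)
    also have "\<dots> = (\<Sum>j\<in>UNIV. \<Sum>h\<in>UNIV. \<Sum>l\<in>UNIV. G $ (i, g) $ (j, h) * (G $ (j, h) $ (k, l) * character \<alpha> l))"
      by (intro sum.cong refl sum.swap)
    also have "\<dots> = (\<Sum>j\<in>UNIV. \<Sum>h\<in>UNIV. fourier_slice G \<alpha> $ j $ k * (G $ (i, g) $ (j, h) * character \<alpha> h))"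
      unfolding sum_distrib_left[where r = "G $ _ $ _", symmetric] eig
      by (intro sum.cong refl) (simp only: mult_ac)
    also have "\<dots> = (\<Sum>j\<in>UNIV. fourier_slice G \<alpha> $ j $ k * (\<Sum>h\<in>UNIV. G $ (i, g) $ (j, h) * character \<alpha> h))"
      by (simp only: sum_distrib_left)
    also have "\<dots> = (\<Sum>j\<in>UNIV. fourier_slice G \<alpha> $ i $ j * fourier_slice G \<alpha> $ j $ k) * character \<alpha> g"
      unfolding eig sum_distrib_right by (simp add: mult_ac)
    finally show ?thesis .
  qed
  \<comment> \<open>Averaging against the conjugate character over \<open>g\<close> strips the
    factor \<open>character \<alpha> g\<close> from \<open>inner\<close>.\<close>
  have "of_real c * fourier_slice G \<alpha> $ i $ k =
      (\<Sum>g\<in>(UNIV :: 'g set). cnj (character \<alpha> g) * (\<Sum>l\<in>UNIV. of_real c * G $ (i, g) $ (k, l) * character \<alpha> l)) / of_nat CARD('g)"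
    by (simp add: fourier_slice_nth sum_distrib_left mult_ac)
  also have "\<dots> = (\<Sum>g\<in>(UNIV :: 'g set). \<Sum>j\<in>UNIV. fourier_slice G \<alpha> $ i $ j * fourier_slice G \<alpha> $ j $ k) / of_nat CARD('g)"
    unfolding inner by (intro arg_cong2[of _ _ _ _ "(/)"] sum.cong refl) (simp add: mult.left_commute[of "cnj _"])
  finally show ?thesis by simp
qed


section \<open>Fourier series and generators for the regular representation\<close>

definition inverse_fourier ::
  "(('g :: {ab_group_add, finite}) pontryagin_dual \<Rightarrow> complex) \<Rightarrow> 'g \<Rightarrow> complex" where
  "inverse_fourier c x = (\<Sum>\<alpha>\<in>UNIV. c \<alpha> * character \<alpha> x) / of_nat CARD('g)"

text \<open>The sum over \<open>x\<close> keeps only equal characters and cancels one of the two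
  factors 1 / \<open>CARD('g)\<close>.\<close>

lemma parseval:
  fixes c d :: "('g :: {ab_group_add, finite}) pontryagin_dual \<Rightarrow> complex"
  shows "(\<Sum>x\<in>UNIV. cnj (inverse_fourier c x) * inverse_fourier d x) =
    (\<Sum>\<alpha>\<in>UNIV. cnj (c \<alpha>) * d \<alpha>) / of_nat CARD('g)"
proof -
  let ?m = "of_nat CARD('g) :: complex"
  have "(\<Sum>x\<in>UNIV. cnj (inverse_fourier c x) * inverse_fourier d x) =
      (\<Sum>x\<in>UNIV. \<Sum>\<alpha>\<in>UNIV. \<Sum>\<beta>\<in>UNIV.
        cnj (c \<alpha>) * d \<beta> / (?m * ?m) * (cnj (character \<alpha> x) * character \<beta> x))"
    unfolding inverse_fourier_def sum_divide_distrib cnj_sum sum_product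
    by (intro sum.cong refl) simp
  also have "\<dots> = (\<Sum>\<alpha>\<in>UNIV. \<Sum>x\<in>UNIV. \<Sum>\<beta>\<in>UNIV.
        cnj (c \<alpha>) * d \<beta> / (?m * ?m) * (cnj (character \<alpha> x) * character \<beta> x))"
    by (rule sum.swap)
  also have "\<dots> = (\<Sum>\<alpha>\<in>UNIV. \<Sum>\<beta>\<in>UNIV. \<Sum>x\<in>UNIV.
        cnj (c \<alpha>) * d \<beta> / (?m * ?m) * (cnj (character \<alpha> x) * character \<beta> x))"
    by (intro sum.cong refl sum.swap)
  also have "\<dots> = (\<Sum>\<alpha>\<in>UNIV. \<Sum>\<beta>\<in>UNIV. if \<alpha> = \<beta> then cnj (c \<alpha>) * d \<beta> / ?m else 0)"
    unfolding sum_distrib_left[symmetric] sum_character by (intro sum.cong refl) simp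
  finally show ?thesis
    by (simp add: sum_divide_distrib)
qed

lemma inverse_fourier_diff:
  "inverse_fourier c (x - g) = inverse_fourier (\<lambda>\<alpha>. c \<alpha> * cnj (character \<alpha> g)) x"
  by (simp add: inverse_fourier_def character_diff mult_ac)

text \<open>The translation \<open>g\<close> becomes the variable while \<open>x\<close> is fixed,
  which makes \<open>parseval\<close> applicable to sums over translations.\<close>

lemma cnj_inverse_fourier_diff:
  "cnj (inverse_fourier c (x - g)) = inverse_fourier (\<lambda>\<alpha>. cnj (c \<alpha> * character \<alpha> x)) g"
  by (simp add: inverse_fourier_def character_diff mult_ac)

text \<open>The regular representation contains every character only once, so this construction
  rests on each slice having rank one. The second identity says that the translates form a tight
  frame; it holds because all slices have the same trace.\<close>

lemma ex_regular_generators: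
  fixes G :: "('t :: finite \<times> 'g :: {ab_group_add, finite}) square"
  assumes diag: "\<And>i j. diagonal (fourier_conj (block G i j))"
    and psd: "\<And>\<alpha>. psd (fourier_slice G \<alpha>)"
    and square: "G ** G = real CARD('t) *\<^sub>R G"
    and trace: "(\<Sum>i\<in>UNIV. block G i i) = real CARD('t) *\<^sub>R mat 1"
  shows "\<exists>\<psi> :: 't \<Rightarrow> 'g \<Rightarrow> complex.
    (\<forall>i j g h. (\<Sum>x\<in>UNIV. cnj (\<psi> i (x - g)) * \<psi> j (x - h)) = G $ (i, g) $ (j, h)) \<and>
    (\<forall>x y. (\<Sum>i\<in>UNIV. \<Sum>h\<in>UNIV. \<psi> i (x - h) * cnj (\<psi> i (y - h))) =
      (if x = y then of_nat CARD('t) else 0))"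
proof -
  note tr = trace_fourier_slice[OF trace]
  have "\<exists>b. \<forall>i j. fourier_slice G \<alpha> $ i $ j = cnj (b i) * b j" for \<alpha>
    by (rule psd_rank_one[OF psd tr]) (simp_all add: square_fourier_slice[OF diag square])
  then obtain b where b: "\<And>\<alpha> i j. fourier_slice G \<alpha> $ i $ j = cnj (b \<alpha> i) * b \<alpha> j"
    by metis
  \<comment> \<open>With the factor 1 / \<open>CARD('g)\<close> in \<open>inverse_fourier\<close>,
    \<open>parseval\<close> has the same normalisation as \<open>nth_eq_sum_fourier_slice\<close>,
    and no rescaling of \<open>b\<close> is required.\<close>
  define \<psi> where "\<psi> i = inverse_fourier (\<lambda>\<alpha>. b \<alpha> i)" for i
  show ?thesis
  proof (intro exI[of _ \<psi>] conjI allI)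
    show "(\<Sum>x\<in>UNIV. cnj (\<psi> i (x - g)) * \<psi> j (x - h)) = G $ (i, g) $ (j, h)" for i j g h
      unfolding \<psi>_def inverse_fourier_diff parseval nth_eq_sum_fourier_slice[OF diag] b
      by (simp add: mult_ac)
    show "(\<Sum>i\<in>UNIV. \<Sum>h\<in>UNIV. \<psi> i (x - h) * cnj (\<psi> i (y - h))) =
      (if x = y then of_nat CARD('t) else 0)" for x y
    proof -
      have "(\<Sum>i\<in>UNIV. \<Sum>h\<in>UNIV. \<psi> i (x - h) * cnj (\<psi> i (y - h))) =
          (\<Sum>i\<in>UNIV. \<Sum>h\<in>UNIV. cnj (cnj (\<psi> i (x - h))) * cnj (\<psi> i (y - h)))"
        by simp
      \<comment> \<open>Here \<open>parseval\<close> acts in the variable \<open>h\<close>, and the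
        squared moduli of \<open>b\<close> are diagonal entries of the slices.\<close>
      also have "\<dots> = (\<Sum>i\<in>UNIV. \<Sum>\<alpha>\<in>UNIV.
          fourier_slice G \<alpha> $ i $ i * (character \<alpha> x * cnj (character \<alpha> y)) / of_nat CARD('g))"
        unfolding \<psi>_def cnj_inverse_fourier_diff parseval b sum_divide_distrib
        by (intro sum.cong refl) (simp add: mult_ac)
      also have "\<dots> = (\<Sum>\<alpha>\<in>UNIV. \<Sum>i\<in>UNIV.
          fourier_slice G \<alpha> $ i $ i * (character \<alpha> x * cnj (character \<alpha> y)) / of_nat CARD('g))"
        by (rule sum.swap)
      also have "\<dots> = of_nat CARD('t) * (\<Sum>\<alpha>\<in>UNIV. character \<alpha> x * cnj (character \<alpha> y)) / of_nat CARD('g)"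
        unfolding sum_divide_distrib[symmetric] sum_distrib_right[symmetric] tr
        by (simp add: sum_distrib_left)
      also have "\<dots> = (if x = y then of_nat CARD('t) else 0)"
        unfolding sum_dual_character by simp
      finally show ?thesis .
    qed
  qed
qed

section \<open>The regular representation in coordinates\<close>

lemma regular_rep_carrier: "regular_rep e g \<in> carrier_mat CARD('g) CARD('g)"
  for e :: "nat \<Rightarrow> 'g :: ab_group_add"
  by (simp add: regular_rep_def)

lemma unitary_rep_regular_rep:
  fixes e :: "nat \<Rightarrow> 'g :: {ab_group_add, finite}"
  assumes "group_enumeration e"
  shows "unitary_rep CARD('g) (regular_rep e)"
proof -
  let ?m = "CARD('g)"
  let ?R = "regular_rep e"
  have e: "bij_betw e {..<?m} UNIV"
    using assms by (simp add: group_enumeration_def)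
  have nth: "?R g $$ (a, b) = (if e b = e a - g then 1 else 0)" if "a < ?m" "b < ?m" for g a b
    using that by (simp add: regular_rep_def)
  have "mat_adjoint (?R g) * ?R g = 1\<^sub>m ?m" for g
  proof (rule eq_matI)
    fix a b assume "a < dim_row (1\<^sub>m ?m)" "b < dim_col (1\<^sub>m ?m)"
    then have ab: "a < ?m" "b < ?m" by simp_all
    then have "(mat_adjoint (?R g) * ?R g) $$ (a, b) = (\<Sum>k<?m. cnj (?R g $$ (k, a)) * ?R g $$ (k, b))"
      using index_mat_adjoint_mult[of a "?R g" b] regular_rep_carrier[of e g] by simp
    \<comment> \<open>Column \<open>a\<close> of this permutation matrix has its only nonzero entry
      in the row that enumerates \<open>e a + g\<close>.\<close>
    also have "\<dots> = (\<Sum>k<?m. if e k = e a + g then if e a = e b then 1 else 0 else 0)"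
      using ab by (intro sum.cong refl) (auto simp: nth algebra_simps)
    also have "\<dots> = (\<Sum>x\<in>UNIV. if x = e a + g then if e a = e b then 1 else 0 else 0)"
      using sum_enumeration[OF e, of "\<lambda>x. if x = e a + g then if e a = e b then 1 else 0 else 0"] .
    also have "\<dots> = 1\<^sub>m ?m $$ (a, b)" using ab by (simp add: enumeration_eq_iff[OF e])
    finally show "(mat_adjoint (?R g) * ?R g) $$ (a, b) = 1\<^sub>m ?m $$ (a, b)" .
  qed (use regular_rep_carrier[of e g] in auto)
  moreover have "?R (g + h) = ?R g * ?R h" for g h
  proof (rule eq_matI)
    fix a b assume "a < dim_row (?R g * ?R h)" "b < dim_col (?R g * ?R h)"
    then have ab: "a < ?m" "b < ?m"
      using regular_rep_carrier[of e g] regular_rep_carrier[of e h] by simp_all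
    then have "(?R g * ?R h) $$ (a, b) = (\<Sum>k<?m. ?R g $$ (a, k) * ?R h $$ (k, b))"
      using regular_rep_carrier[of e g] regular_rep_carrier[of e h]
      by (auto simp: scalar_prod_def atLeast0LessThan)
    also have "\<dots> = (\<Sum>k<?m. if e k = e a - g then ?R (g + h) $$ (a, b) else 0)"
      using ab by (intro sum.cong refl) (auto simp: nth diff_diff_eq[symmetric])
    also have "\<dots> = (\<Sum>x\<in>UNIV. if x = e a - g then ?R (g + h) $$ (a, b) else 0)"
      using sum_enumeration[OF e, of "\<lambda>x. if x = e a - g then ?R (g + h) $$ (a, b) else 0"] .
    also have "\<dots> = ?R (g + h) $$ (a, b)" by simp
    finally show "?R (g + h) $$ (a, b) = (?R g * ?R h) $$ (a, b)" ..
  qed (use regular_rep_carrier[of e g] regular_rep_carrier[of e h] regular_rep_carrier[of e "g + h"] in auto)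
  ultimately show ?thesis
    by (simp add: unitary_rep_def regular_rep_carrier)
qed

lemma regular_rep_mult_vec:
  fixes e :: "nat \<Rightarrow> 'g :: {ab_group_add, finite}"
  assumes "group_enumeration e" "a < CARD('g)"
  shows "vec_index (regular_rep e g *\<^sub>v Matrix.vec CARD('g) (\<lambda>k. \<phi> (e k))) a = \<phi> (e a - g)"
proof -
  let ?m = "CARD('g)"
  have e: "bij_betw e {..<?m} UNIV"
    using assms by (simp add: group_enumeration_def)
  have "vec_index (regular_rep e g *\<^sub>v Matrix.vec ?m (\<lambda>k. \<phi> (e k))) a =
      (\<Sum>b<?m. regular_rep e g $$ (a, b) * vec_index (Matrix.vec ?m (\<lambda>k. \<phi> (e k))) b)"
    by (rule index_mult_mat_vec_sum[OF regular_rep_carrier _ assms(2)]) simp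
  also have "\<dots> = (\<Sum>b<?m. if e b = e a - g then \<phi> (e a - g) else 0)"
    using assms(2) by (intro sum.cong refl) (auto simp: regular_rep_def)
  also have "\<dots> = (\<Sum>x\<in>UNIV. if x = e a - g then \<phi> (e a - g) else 0)"
    using sum_enumeration[OF e, of "\<lambda>x. if x = e a - g then \<phi> (e a - g) else 0"] .
  finally show ?thesis by simp
qed

lemma is_harmonic_gram_regular_rep:
  fixes G :: "('t :: finite \<times> 'g :: {ab_group_add, finite}) square"
  assumes e: "group_enumeration e"
    and \<psi>: "\<And>i j g h. (\<Sum>x\<in>UNIV. cnj (\<psi> i (x - g)) * \<psi> j (x - h)) = G $ (i, g) $ (j, h)"
  shows "is_harmonic_gram CARD('g) (regular_rep e) G"
proof -
  define \<Psi> where "\<Psi> i = Matrix.vec CARD('g) (\<lambda>k. \<psi> i (e k))" for i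
  have harm: "harmonic CARD('g) (regular_rep e) \<Psi>"
    by (simp add: harmonic_def unitary_rep_regular_rep[OF e] \<Psi>_def)
  have "harmonic_gram (regular_rep e) \<Psi> $ (i, g) $ (j, h) = G $ (i, g) $ (j, h)" for i j g h
  proof -
    have "harmonic_gram (regular_rep e) \<Psi> $ (i, g) $ (j, h) =
        (\<Sum>a<CARD('g). cnj (\<psi> i (e a - g)) * \<psi> j (e a - h))"
      unfolding harmonic_gram_nth[OF harm] \<Psi>_def
      by (intro sum.cong refl) (simp only: fst_conv snd_conv regular_rep_mult_vec[OF e] lessThan_iff)
    also have "\<dots> = G $ (i, g) $ (j, h)"
      using sum_enumeration[of e "\<lambda>x. cnj (\<psi> i (x - g)) * \<psi> j (x - h)"] e
      by (simp add: group_enumeration_def \<psi>)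
    finally show ?thesis .
  qed
  then have nth: "G $ p $ q = harmonic_gram (regular_rep e) \<Psi> $ p $ q" for p q
    by (cases p; cases q) simp
  have "G = harmonic_gram (regular_rep e) \<Psi>"
    by (intro Finite_Cartesian_Product.vec_eq_iff[THEN iffD2] allI nth)
  with harm show ?thesis
    unfolding is_harmonic_gram_def by blast
qed

section \<open>Circulant blocks and tight frames\<close>

lemma sum_mult_add:
  fixes f :: "nat \<Rightarrow> 'a :: comm_monoid_add"
  shows "(\<Sum>c<t * m. f c) = (\<Sum>a<t. \<Sum>k<m. f (a * m + k))"
proof -
  have "(\<Sum>k\<in>{a * m..<a * m + m}. f k) = (\<Sum>k<m. f (a * m + k))" for a
    using sum.shift_bounds_nat_ivl[of f 0 "a * m" m] by (simp add: atLeast0LessThan add.commute)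
  then show ?thesis
    using sum.nat_group[of f m t] by simp
qed

lemma mult_add_less:
  fixes a k t m :: nat
  assumes "a < t" "k < m"
  shows "a * m + k < t * m"
proof -
  have "a * m + k < Suc a * m" using assms by simp
  also have "\<dots> \<le> t * m" using assms by (intro mult_le_mono1) simp
  finally show ?thesis .
qed

text \<open>The columns of block \<open>a\<close> are the translates of the generator
  \<open>s a\<close>. Their entries depend only on \<open>e x - e k\<close>, which does not change
  when both indices advance cyclically.\<close>

lemma ex_t_circulant_frame:
  fixes G :: "('t :: finite \<times> 'g :: {ab_group_add, finite}) square"
  assumes e: "cyclic_enumeration e" and s: "bij_betw s {..<CARD('t)} UNIV"
    and \<psi>: "\<And>i j g h. (\<Sum>x\<in>UNIV. cnj (\<psi> i (x - g)) * \<psi> j (x - h)) = G $ (i, g) $ (j, h)"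
    and tight: "\<And>x y. (\<Sum>i\<in>UNIV. \<Sum>h\<in>UNIV. \<psi> i (x - h) * cnj (\<psi> i (y - h))) =
      (if x = y then of_nat CARD('t) else 0)"
  shows "\<exists>\<Phi>. dim_row \<Phi> = CARD('g) \<and> t_circulant CARD('t) \<Phi> \<and> gram_of_columns s e G \<Phi> \<and>
    tight_frame \<Phi> \<and> (equiangular_gram G \<longrightarrow> equiangular_tight_frame \<Phi>)"
proof -
  let ?m = "CARD('g)" and ?t = "CARD('t)"
  have bij: "bij_betw e {..<?m} UNIV"
    using e by (simp add: cyclic_enumeration_def group_enumeration_def)
  have cyc: "e ((k + l) mod ?m) = e k + e l" if "k < ?m" "l < ?m" for k l
    using e that by (simp add: cyclic_enumeration_def)
  have m: "0 < ?m" by simp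
  \<comment> \<open>Column \<open>c\<close> stands for block \<open>c div ?m\<close> and position
    \<open>c mod ?m\<close> within it.\<close>
  define \<Phi> where "\<Phi> = Matrix.mat ?m (?t * ?m) (\<lambda>(x, c). \<psi> (s (c div ?m)) (e x - e (c mod ?m)))"
  have dim: "dim_row \<Phi> = ?m" "dim_col \<Phi> = ?t * ?m" by (simp_all add: \<Phi>_def)
  have nth: "\<Phi> $$ (x, a * ?m + k) = \<psi> (s a) (e x - e k)" if "x < ?m" "a < ?t" "k < ?m" for x a k
    using that by (simp add: \<Phi>_def mult_add_less)
  \<comment> \<open>A cyclic step adds a fixed group element. Its index is \<open>1 mod ?m\<close>,
    which is also valid for the trivial group, where 1 is out of range.\<close>
  have suc: "e (Suc k mod ?m) = e k + e (1 mod ?m)" if "k < ?m" for k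
    using cyc[OF that mod_less_divisor[OF m], of 1] by (simp only: mod_add_right_eq Suc_eq_plus1)
  have shift: "e (Suc i mod ?m) - e (Suc j mod ?m) = e i - e j" if "i < ?m" "j < ?m" for i j
    using that by (simp add: suc)
  have "circulant (Matrix.mat ?m ?m (\<lambda>(i, j). \<Phi> $$ (i, b * ?m + j)))" if "b < ?t" for b
    using that by (simp add: circulant_def nth shift)
  then have circ: "t_circulant ?t \<Phi>"
    by (simp add: t_circulant_def dim)
  have gram: "(mat_adjoint \<Phi> * \<Phi>) $$ (a * ?m + k, b * ?m + l) = G $ (s a, e k) $ (s b, e l)"
    if "a < ?t" "k < ?m" "b < ?t" "l < ?m" for a k b l
  proof -
    have "(mat_adjoint \<Phi> * \<Phi>) $$ (a * ?m + k, b * ?m + l) =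
        (\<Sum>x<?m. cnj (\<psi> (s a) (e x - e k)) * \<psi> (s b) (e x - e l))"
      using that by (subst index_mat_adjoint_mult) (simp_all add: dim mult_add_less nth)
    then show ?thesis
      using sum_enumeration[OF bij, of "\<lambda>x. cnj (\<psi> (s a) (x - e k)) * \<psi> (s b) (x - e l)"]
      by (simp add: \<psi>)
  qed
  have gram': "(mat_adjoint \<Phi> * \<Phi>) $$ (k, l) =
      G $ (s (k div ?m), e (k mod ?m)) $ (s (l div ?m), e (l mod ?m))"
    if "k < ?t * ?m" "l < ?t * ?m" for k l
    using gram[of "k div ?m" "k mod ?m" "l div ?m" "l mod ?m"] that by (simp add: less_mult_imp_div_less)
  have "\<Phi> * mat_adjoint \<Phi> = of_nat ?t \<cdot>\<^sub>m 1\<^sub>m (dim_row \<Phi>)"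
  proof (rule eq_matI)
    fix x y assume "x < dim_row (of_nat ?t \<cdot>\<^sub>m 1\<^sub>m (dim_row \<Phi>) :: complex mat)"
      "y < dim_col (of_nat ?t \<cdot>\<^sub>m 1\<^sub>m (dim_row \<Phi>) :: complex mat)"
    then have xy: "x < ?m" "y < ?m" by (simp_all add: dim)
    then have "(\<Phi> * mat_adjoint \<Phi>) $$ (x, y) = (\<Sum>c<?t * ?m. \<Phi> $$ (x, c) * cnj (\<Phi> $$ (y, c)))"
      by (simp add: dim scalar_prod_def index_mat_adjoint atLeast0LessThan)
    also have "\<dots> = (\<Sum>a<?t. \<Sum>k<?m. \<psi> (s a) (e x - e k) * cnj (\<psi> (s a) (e y - e k)))"
      unfolding sum_mult_add using xy by (simp add: nth)
    also have "\<dots> = (\<Sum>a<?t. \<Sum>h\<in>UNIV. \<psi> (s a) (e x - h) * cnj (\<psi> (s a) (e y - h)))"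
      by (intro sum.cong refl sum_enumeration[OF bij])
    also have "\<dots> = (\<Sum>i\<in>UNIV. \<Sum>h\<in>UNIV. \<psi> i (e x - h) * cnj (\<psi> i (e y - h)))"
      using sum_enumeration[OF s, of "\<lambda>i. \<Sum>h\<in>UNIV. \<psi> i (e x - h) * cnj (\<psi> i (e y - h))"] .
    also have "\<dots> = (of_nat ?t \<cdot>\<^sub>m 1\<^sub>m (dim_row \<Phi>)) $$ (x, y)"
      using xy by (simp add: tight dim enumeration_eq_iff[OF bij])
    finally show "(\<Phi> * mat_adjoint \<Phi>) $$ (x, y) = (of_nat ?t \<cdot>\<^sub>m 1\<^sub>m (dim_row \<Phi>)) $$ (x, y)" .
  qed simp_all
  then have tf: "tight_frame \<Phi>"
    unfolding tight_frame_def by blast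
  have "equiangular_tight_frame \<Phi>" if eq: "equiangular_gram G"
  proof -
    from eq obtain \<mu> where one: "\<And>p. G $ p $ p = 1" and \<mu>: "\<And>p q. p \<noteq> q \<Longrightarrow> cmod (G $ p $ q) = \<mu>"
      unfolding equiangular_gram_def by blast
    have "col \<Phi> k \<bullet>c col \<Phi> k = 1" if "k < dim_col \<Phi>" for k
    proof -
      have "col \<Phi> k \<bullet>c col \<Phi> k = (mat_adjoint \<Phi> * \<Phi>) $$ (k, k)"
        using that by (subst index_mat_adjoint_mult) (simp_all add: cscalar_prod_sum[of _ "dim_row \<Phi>"])
      also have "\<dots> = 1"
        unfolding gram'[OF that[unfolded dim] that[unfolded dim]] by (rule one)
      finally show ?thesis .
    qed
    moreover have "cmod ((mat_adjoint \<Phi> * \<Phi>) $$ (k, l)) = \<mu>"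
      if "k < dim_col \<Phi>" "l < dim_col \<Phi>" "k \<noteq> l" for k l
    proof -
      have kl: "k < ?t * ?m" "l < ?t * ?m" using that by (simp_all add: dim)
      \<comment> \<open>Distinct columns must have distinct labels, so that the off-diagonal bound
        on \<open>G\<close> applies: both enumerations are injective, and a number is determined by
        its quotient and remainder.\<close>
      have "(s (k div ?m), e (k mod ?m)) \<noteq> (s (l div ?m), e (l mod ?m))"
      proof
        assume "(s (k div ?m), e (k mod ?m)) = (s (l div ?m), e (l mod ?m))"
        then have "k div ?m = l div ?m" "k mod ?m = l mod ?m"
          using kl by (simp_all add: enumeration_eq_iff[OF s] enumeration_eq_iff[OF bij] less_mult_imp_div_less)
        with \<open>k \<noteq> l\<close> show False by (metis div_mult_mod_eq)
      qed
      with \<mu> show ?thesis unfolding gram'[OF kl] by blast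
    qed
    ultimately show ?thesis
      unfolding equiangular_tight_frame_def using tf by blast
  qed
  moreover have "gram_of_columns s e G \<Phi>"
    by (simp add: gram_of_columns_def dim gram)
  ultimately show ?thesis
    using dim(1) circ tf by blast
qed

text \<open>Quantification over all enumerations makes the result independent of how functions on
  the group become vectors. A \<open>cyclic_enumeration\<close> exists only for cyclic groups, which
  expresses the case of C_m. The frame is tight in any case; equiangularity is inherited from
  \<open>G\<close>.\<close>

theorem theorem23:
  fixes G :: "('t :: finite \<times> 'g :: {ab_group_add, finite}) square"
  shows "((\<exists>d \<rho>. is_harmonic_gram d \<rho> G) \<longleftrightarrow> psd G \<and> (\<forall>i j. group_stable (block G i j))) \<and>
    (psd G \<and> (\<forall>i j. group_stable (block G i j)) \<longleftrightarrow>
      (\<forall>i j. diagonal (fourier_conj (block G i j))) \<and> (\<forall>\<alpha>. psd (fourier_slice G \<alpha>))) \<and>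
    ((\<exists>d \<rho>. is_harmonic_gram d \<rho> G) \<and>
      G ** G = real CARD('t) *\<^sub>R G \<and>
      (\<Sum>i\<in>UNIV. block G i i) = real CARD('t) *\<^sub>R mat 1 \<longrightarrow>
      (\<forall>e. group_enumeration e \<longrightarrow> is_harmonic_gram CARD('g) (regular_rep e) G) \<and>
      (\<forall>e s. cyclic_enumeration e \<and> bij_betw s {..<CARD('t)} UNIV \<longrightarrow>
        (\<exists>\<Phi>. dim_row \<Phi> = CARD('g) \<and> t_circulant CARD('t) \<Phi> \<and> gram_of_columns s e G \<Phi> \<and>
          tight_frame \<Phi> \<and> (equiangular_gram G \<longrightarrow> equiangular_tight_frame \<Phi>))))"
    (is "(?a \<longleftrightarrow> ?b) \<and> (?b \<longleftrightarrow> ?c) \<and> (?a \<and> ?square \<and> ?trace \<longrightarrow> ?regular \<and> ?circulant)")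
proof -
  have ab: ?b if ?a
    using that psd_harmonic_gram group_stable_harmonic_gram unfolding is_harmonic_gram_def by blast
  have bc: ?c if ?b
    using that by (simp add: group_stable_iff_diagonal psd_fourier_slice)
  have ca: ?a if ?c
    using that ex_is_harmonic_gram by blast
  have "?regular \<and> ?circulant" if a: ?a and sq: ?square and tr: ?trace
  proof -
    have diag: "\<And>i j. diagonal (fourier_conj (block G i j))" and psd: "\<And>\<alpha>. psd (fourier_slice G \<alpha>)"
      using bc[OF ab[OF a]] by blast+
    obtain \<psi> :: "'t \<Rightarrow> 'g \<Rightarrow> complex"
      where \<psi>: "\<And>i j g h. (\<Sum>x\<in>UNIV. cnj (\<psi> i (x - g)) * \<psi> j (x - h)) = G $ (i, g) $ (j, h)"
        and tight: "\<And>x y. (\<Sum>i\<in>UNIV. \<Sum>h\<in>UNIV. \<psi> i (x - h) * cnj (\<psi> i (y - h))) =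
          (if x = y then of_nat CARD('t) else 0)"
      using ex_regular_generators[OF diag psd sq tr] by blast
    show ?thesis
    proof (intro conjI allI impI)
      show "is_harmonic_gram CARD('g) (regular_rep e) G" if "group_enumeration e" for e
        by (rule is_harmonic_gram_regular_rep[OF that \<psi>])
      show "\<exists>\<Phi>. dim_row \<Phi> = CARD('g) \<and> t_circulant CARD('t) \<Phi> \<and> gram_of_columns s e G \<Phi> \<and>
          tight_frame \<Phi> \<and> (equiangular_gram G \<longrightarrow> equiangular_tight_frame \<Phi>)"
        if "cyclic_enumeration e \<and> bij_betw s {..<CARD('t)} UNIV" for e s
        using that by (intro ex_t_circulant_frame[OF _ _ \<psi> tight]) simp_all
    qed
  qed
  with ab bc ca show ?thesis by blast
qed

end
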